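(* The vessel speed optimization problem \begin{align*} \min_{t\in\mathbb{R}^{n+1},\ v\in\mathbb{R}^n}\ &\sum_{i=1}^n d_i\,c(v_i)\\ \text{s.t. }\ & t_{i-1}+\frac{d_i}{v_i}=t_i,\quad i\in\{1,\ldots,n\},\\ & A_i\le t_i\le D_i,\quad i\in\{1,\ldots,n-1\},\\ & t_0=t^{\text{start}},\quad t_n=t^{\text{end}},\\ & v^{\min}\le v_i\le v^{\max},\quad i\in\{1,\ldots,n\}, \end{align*} where $c$ is a non-decreasing convex function, can be solved in $O(n\log n)$ time.
   Context: A ship sails a route through ports $0,1,\ldots,n$, leaving port $0$ at time $t^{\text{start}}$ and required to finish at port $n$ at time $t^{\text{end}}$; $t=(t_0,\ldots,t_n)$. The distance between consecutive ports $i-1$ and $i$ is $d_i>0$; port $i$ must be serviced within the time window $[A_i,D_i]$; $v_i$ is the sailing speed on leg $i$; $0<v^{\min}\le v^{\max}$ are the minimum and maximum cruising speeds; $c(v)$ is the fuel cost per unit distance at speed $v$. Solving the problem means computing an optimal solution. *)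

theory Defs
  imports Complex_Main "HOL-Analysis.Convex" "HOL-Library.Landau_Symbols"
begin

(* Vectors are functions on nat. Only dist 1..n, win_open and win_close 1..n-1, t 0..n and
   v 1..n are meaningful. *)
record instance_data =
  legs :: nat                     (* n *)
  dist :: "nat \<Rightarrow> real"      (* d *)
  win_open :: "nat \<Rightarrow> real"  (* A *)
  win_close :: "nat \<Rightarrow> real" (* D *)
  t_start :: real
  t_end :: real
  v_min :: real
  v_max :: real
  fuel :: "real \<Rightarrow> real"      (* c *)

(* The cost function is only constrained on the admissible speeds, so a c defined on a larger
   interval, on all positive reals or on all reals is covered. Nothing is assumed about the
   time windows, so an instance may be infeasible. *)
definition speed_instance :: "instance_data \<Rightarrow> bool" where
  "speed_instance I \<longleftrightarrow>
     1 \<le> legs I \<and>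
     (\<forall>i\<in>{1..legs I}. 0 < dist I i) \<and>
     0 < v_min I \<and> v_min I \<le> v_max I \<and>
     mono_on {v_min I..v_max I} (fuel I) \<and>
     convex_on {v_min I..v_max I} (fuel I)"

definition feasible :: "instance_data \<Rightarrow> (nat \<Rightarrow> real) \<times> (nat \<Rightarrow> real) \<Rightarrow> bool" where
  "feasible I = (\<lambda>(t, v).
     (\<forall>i\<in>{1..legs I}. t (i - 1) + dist I i / v i = t i) \<and>
     (\<forall>i\<in>{1..legs I - 1}. win_open I i \<le> t i \<and> t i \<le> win_close I i) \<and>
     t 0 = t_start I \<and> t (legs I) = t_end I \<and>
     (\<forall>i\<in>{1..legs I}. v_min I \<le> v i \<and> v i \<le> v_max I))"

definition total_cost :: "instance_data \<Rightarrow> (nat \<Rightarrow> real) \<times> (nat \<Rightarrow> real) \<Rightarrow> real" where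
  "total_cost I = (\<lambda>(t, v). \<Sum>i=1..legs I. dist I i * fuel I (v i))"

definition optimal_solution :: "instance_data \<Rightarrow> (nat \<Rightarrow> real) \<times> (nat \<Rightarrow> real) \<Rightarrow> bool" where
  "optimal_solution I = is_arg_min (total_cost I) (feasible I)"


(* Time is counted on a unit-cost real RAM, programmed in a while language. The memory consists
   of named arrays of naturals (for counters and indices) and of reals; a scalar is cell 0 of an
   array. Indices can be added and subtracted (truncated at 0), reals admit the four field
   operations and comparison. There is no rounding or other conversion from reals to naturals,
   and program constants are integers. The cost function c is available as an evaluation oracle,
   charged like an arithmetic operation. *)
type_synonym name = string

datatype nexp =
    NConst nat
  | NGet name nexp
  | NAdd nexp nexp
  | NSub nexp nexp

datatype rexp =
    RConst int
  | RGet name nexp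
  | RAdd rexp rexp
  | RSub rexp rexp
  | RMul rexp rexp
  | RDiv rexp rexp
  | ROracle rexp

datatype bexp =
    NLess nexp nexp
  | RLess rexp rexp
  | Not bexp
  | And bexp bexp

datatype com =
    Skip
  | NSet name nexp nexp
  | RSet name nexp rexp
  | Seq com com
  | If bexp com com
  | While bexp com

record store =
  nats :: "name \<Rightarrow> nat \<Rightarrow> nat"
  reals :: "name \<Rightarrow> nat \<Rightarrow> real"

fun nval :: "nexp \<Rightarrow> store \<Rightarrow> nat" where
  "nval (NConst k) s = k"
| "nval (NGet x e) s = nats s x (nval e s)"
| "nval (NAdd e f) s = nval e s + nval f s"
| "nval (NSub e f) s = nval e s - nval f s"

fun rval :: "(real \<Rightarrow> real) \<Rightarrow> rexp \<Rightarrow> store \<Rightarrow> real" where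
  "rval c (RConst k) s = of_int k"
| "rval c (RGet x e) s = reals s x (nval e s)"
| "rval c (RAdd e f) s = rval c e s + rval c f s"
| "rval c (RSub e f) s = rval c e s - rval c f s"
| "rval c (RMul e f) s = rval c e s * rval c f s"
| "rval c (RDiv e f) s = rval c e s / rval c f s"
| "rval c (ROracle e) s = c (rval c e s)"

fun bval :: "(real \<Rightarrow> real) \<Rightarrow> bexp \<Rightarrow> store \<Rightarrow> bool" where
  "bval c (NLess e f) s \<longleftrightarrow> nval e s < nval f s"
| "bval c (RLess e f) s \<longleftrightarrow> rval c e s < rval c f s"
| "bval c (Not b) s \<longleftrightarrow> \<not> bval c b s"
| "bval c (And a b) s \<longleftrightarrow> bval c a s \<and> bval c b s"

(* Evaluating an expression costs one time unit per node. *)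
fun ncost :: "nexp \<Rightarrow> nat" where
  "ncost (NConst k) = 1"
| "ncost (NGet x e) = 1 + ncost e"
| "ncost (NAdd e f) = 1 + ncost e + ncost f"
| "ncost (NSub e f) = 1 + ncost e + ncost f"

fun rcost :: "rexp \<Rightarrow> nat" where
  "rcost (RConst k) = 1"
| "rcost (RGet x e) = 1 + ncost e"
| "rcost (RAdd e f) = 1 + rcost e + rcost f"
| "rcost (RSub e f) = 1 + rcost e + rcost f"
| "rcost (RMul e f) = 1 + rcost e + rcost f"
| "rcost (RDiv e f) = 1 + rcost e + rcost f"
| "rcost (ROracle e) = 1 + rcost e"

fun bcost :: "bexp \<Rightarrow> nat" where
  "bcost (NLess e f) = 1 + ncost e + ncost f"
| "bcost (RLess e f) = 1 + rcost e + rcost f"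
| "bcost (Not b) = 1 + bcost b"
| "bcost (And a b) = 1 + bcost a + bcost b"

definition nset :: "name \<Rightarrow> nat \<Rightarrow> nat \<Rightarrow> store \<Rightarrow> store" where
  "nset x i a s = s\<lparr>nats := (nats s)(x := (nats s x)(i := a))\<rparr>"

definition rset :: "name \<Rightarrow> nat \<Rightarrow> real \<Rightarrow> store \<Rightarrow> store" where
  "rset x i a s = s\<lparr>reals := (reals s)(x := (reals s x)(i := a))\<rparr>"

(* exec c P s k s': with oracle c, program P started in s halts in s' after k time units. *)
inductive exec :: "(real \<Rightarrow> real) \<Rightarrow> com \<Rightarrow> store \<Rightarrow> nat \<Rightarrow> store \<Rightarrow> bool" for c where
  Skip: "exec c Skip s 1 s"
| NSet: "exec c (NSet x e f) s (1 + ncost e + ncost f) (nset x (nval e s) (nval f s) s)"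
| RSet: "exec c (RSet x e f) s (1 + ncost e + rcost f) (rset x (nval e s) (rval c f s) s)"
| Seq: "\<lbrakk>exec c P s k s'; exec c Q s' l s''\<rbrakk> \<Longrightarrow> exec c (Seq P Q) s (k + l) s''"
| IfTrue: "\<lbrakk>bval c b s; exec c P s k s'\<rbrakk> \<Longrightarrow> exec c (If b P Q) s (1 + bcost b + k) s'"
| IfFalse: "\<lbrakk>\<not> bval c b s; exec c Q s k s'\<rbrakk> \<Longrightarrow> exec c (If b P Q) s (1 + bcost b + k) s'"
| WhileFalse: "\<not> bval c b s \<Longrightarrow> exec c (While b P) s (1 + bcost b) s"
| WhileTrue: "\<lbrakk>bval c b s; exec c P s k s'; exec c (While b P) s' l s''\<rbrakk>
    \<Longrightarrow> exec c (While b P) s (1 + bcost b + k + l) s''"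

(* The program sees the data of the instance and nothing else: all other cells start as 0. *)
definition input_store :: "instance_data \<Rightarrow> store" where
  "input_store I = \<lparr>
     nats = (\<lambda>x i. if x = ''n'' \<and> i = 0 then legs I else 0),
     reals = (\<lambda>x i.
       if x = ''d'' \<and> i \<in> {1..legs I} then dist I i
       else if x = ''A'' \<and> i \<in> {1..legs I - 1} then win_open I i
       else if x = ''D'' \<and> i \<in> {1..legs I - 1} then win_close I i
       else if x = ''t_start'' \<and> i = 0 then t_start I
       else if x = ''t_end'' \<and> i = 0 then t_end I
       else if x = ''v_min'' \<and> i = 0 then v_min I
       else if x = ''v_max'' \<and> i = 0 then v_max I
       else 0)\<rparr>"

(* The final store holds the flag ''feasible'' and, if it is 1, a solution in ''t'' and ''v''. *)
definition correct_output :: "instance_data \<Rightarrow> store \<Rightarrow> bool" where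
  "correct_output I s \<longleftrightarrow>
     (if \<exists>x. feasible I x
      then nats s ''feasible'' 0 = 1 \<and> optimal_solution I (reals s ''t'', reals s ''v'')
      else nats s ''feasible'' 0 = 0)"

(* One program for all instances, including all n and all cost functions; T bounds its
   worst-case running time as a function of n. *)
definition solves_in_time :: "com \<Rightarrow> (nat \<Rightarrow> nat) \<Rightarrow> bool" where
  "solves_in_time P T \<longleftrightarrow>
     (\<forall>I. speed_instance I \<longrightarrow>
        (\<exists>k s. exec (fuel I) P (input_store I) k s \<and> k \<le> T (legs I) \<and> correct_output I s))"

end

(* In the plane of distance and time, choosing arrival times means drawing a path through the
   windows, and the cost is a convex function of the slopes 1 / v. Any such cost, including the
   indicator of the speed bounds, is minimised by the taut string through the windows, which bends
   only at a deadline (towards lower speed) or at an opening time (towards higher speed). Hence the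
   string can be computed from the windows alone: it is feasible and optimal unless the instance
   is infeasible.

   Going backwards, the time at which the string through the remaining windows leaves a node is a
   decreasing piecewise linear function of its initial slope. Passing a window cuts off both ends
   of this function. Its pieces are kept in a deque, so that all cuts together take linear time.
   The slopes lo and hi at the two cuts suffice to recover the string: going forwards, the slope is
   clamped to [lo, hi] at every node. *)
theory Submission
  imports Defs "HOL-Real_Asymp.Real_Asymp"
begin

section \<open>Optimality of the taut string\<close>

text \<open>A convex function may have no finite subgradient at the ends of its domain; relative to
  finitely many points it always has one.\<close>
lemma finite_subgradient:
  fixes f :: "real \<Rightarrow> real"
  assumes "convex_on S f" "finite F" "F \<subseteq> S"
  obtains g where "\<And>x y. x \<in> F \<Longrightarrow> y \<in> F \<Longrightarrow> f x + g x * (y - x) \<le> f y"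
    and "\<And>x y. x \<in> F \<Longrightarrow> y \<in> F \<Longrightarrow> x \<le> y \<Longrightarrow> g x \<le> g y"
proof -
  define sl where "sl x y = (f x - f y) / (x - y)" for x y
  have sl: "sl x y \<le> sl y z" if "x \<in> F" "y \<in> F" "z \<in> F" "x < y" "y < z" for x y z
    using convex_on_slope_le[OF assms(1), of x z y] that assms(3) by (force simp: sl_def)
  define U where "U x = {y \<in> F. x < y}" for x
  define L where "L x = {y \<in> F. y < x}" for x
  \<comment> \<open>By convexity the smallest chord slope to the right is the slope to the next
    point of \<open>F\<close>. The largest point of \<open>F\<close> takes its largest left slope
    instead, and \<open>0\<close> serves a one-point \<open>F\<close>.\<close>
  define g where "g x = (if U x \<noteq> {} then Min (sl x ` U x) else
      if L x \<noteq> {} then Max ((\<lambda>y. sl y x) ` L x) else 0)" for x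
  have fin: "finite (U x)" "finite (L x)" for x
    using assms(2) by (auto simp: U_def L_def)
  have up: "g x \<le> sl x y" if "x \<in> F" "y \<in> F" "x < y" for x y
  proof -
    have "y \<in> U x" using that by (simp add: U_def)
    then show ?thesis using fin by (auto simp: g_def intro!: Min_le)
  qed
  have down: "sl y x \<le> g x" if "x \<in> F" "y \<in> F" "y < x" for x y
  proof (cases "U x = {}")
    case True
    have "y \<in> L x" using that by (simp add: L_def)
    then show ?thesis using fin True by (auto simp: g_def intro!: Max_ge)
  next
    case False
    then have "g x \<in> sl x ` U x"
      using fin Min_in[of "sl x ` U x"] by (simp add: g_def)
    then show ?thesis using sl that by (auto simp: U_def)
  qed
  show thesis
  proof (rule that[of g])
    fix x y assume xy: "x \<in> F" "y \<in> F"
    consider "x < y" | "x = y" | "y < x" by linarith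
    then show "f x + g x * (y - x) \<le> f y"
    proof cases
      case 1
      then show ?thesis using up[OF xy 1] by (simp add: sl_def field_simps)
    next
      case 3
      then show ?thesis using down[OF xy 3] by (simp add: sl_def field_simps)
    qed simp
  next
    fix x y assume "x \<in> F" "y \<in> F" "x \<le> y"
    then show "g x \<le> g y"
      \<comment> \<open>The slope of the chord from \<open>x\<close> to \<open>y\<close> lies
        between \<open>g x\<close> and \<open>g y\<close>.\<close>
      using up[of x y] down[of y x] by (cases "x = y") auto
  qed
qed

text \<open>Abel summation. It is applied with \<open>w\<close> vanishing at both ends, which leaves
  only the contributions of the interior nodes.\<close>

lemma sum_by_parts:
  fixes g w :: "nat \<Rightarrow> real"
  shows "(\<Sum>i=1..Suc n. g i * (w i - w (i - 1))) =
    g (Suc n) * w (Suc n) - g 1 * w 0 + (\<Sum>i=1..n. (g i - g (Suc i)) * w i)"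
  by (induction n) (auto simp: algebra_simps)

text \<open>Subgradients bound the cost difference from below by the sum of \<open>g (p i)\<close>
  times the increments of \<open>w = s - t\<close>. After summation by parts every interior node
  contributes a nonnegative product: \<open>g\<close> is monotone, and \<open>w\<close> has the
  matching sign wherever the slope of \<open>t\<close> changes.\<close>

theorem taut_optimal:
  fixes d p q s t :: "nat \<Rightarrow> real"
  assumes d: "\<And>i. i \<in> {1..n} \<Longrightarrow> 0 \<le> d i"
    and t: "\<And>i. i \<in> {1..n} \<Longrightarrow> t i - t (i - 1) = d i * p i"
    and s: "\<And>i. i \<in> {1..n} \<Longrightarrow> s i - s (i - 1) = d i * q i"
    and ends: "s 0 = t 0" "s n = t n"
    and up: "\<And>i. i \<in> {1..<n} \<Longrightarrow> p i < p (Suc i) \<Longrightarrow> s i \<le> t i"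
    and down: "\<And>i. i \<in> {1..<n} \<Longrightarrow> p (Suc i) < p i \<Longrightarrow> t i \<le> s i"
    and f: "convex_on S f"
    and S: "\<And>i. i \<in> {1..n} \<Longrightarrow> p i \<in> S" "\<And>i. i \<in> {1..n} \<Longrightarrow> q i \<in> S"
  shows "(\<Sum>i=1..n. d i * f (p i)) \<le> (\<Sum>i=1..n. d i * f (q i))"
proof (cases n)
  case (Suc m)
  have "finite (p ` {1..n} \<union> q ` {1..n})" "p ` {1..n} \<union> q ` {1..n} \<subseteq> S"
    using S by auto
  from finite_subgradient[OF f this] obtain g where
    g: "\<And>x y. x \<in> p ` {1..n} \<union> q ` {1..n} \<Longrightarrow> y \<in> p ` {1..n} \<union> q ` {1..n} \<Longrightarrow>
          f x + g x * (y - x) \<le> f y"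
    and mono: "\<And>x y. x \<in> p ` {1..n} \<union> q ` {1..n} \<Longrightarrow> y \<in> p ` {1..n} \<union> q ` {1..n} \<Longrightarrow>
          x \<le> y \<Longrightarrow> g x \<le> g y"
    by metis
  define w where "w i = s i - t i" for i
  have "0 \<le> (g (p i) - g (p (Suc i))) * w i" if i: "i \<in> {1..m}" for i
  proof -
    have iF: "p i \<in> p ` {1..n} \<union> q ` {1..n}" "p (Suc i) \<in> p ` {1..n} \<union> q ` {1..n}"
      using i Suc by auto
    consider "p i < p (Suc i)" | "p i = p (Suc i)" | "p (Suc i) < p i" by linarith
    then show ?thesis
    proof cases
      case 1
      then have "g (p i) \<le> g (p (Suc i))" "w i \<le> 0"
        using mono iF up[of i] i Suc by (auto simp: w_def)
      then show ?thesis by (simp add: mult_nonpos_nonpos)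
    next
      case 3
      then have "g (p (Suc i)) \<le> g (p i)" "0 \<le> w i"
        using mono iF down[of i] i Suc by (auto simp: w_def)
      then show ?thesis by simp
    qed simp
  qed
  then have "0 \<le> (\<Sum>i=1..m. (g (p i) - g (p (Suc i))) * w i)"
    by (rule sum_nonneg)
  also have "\<dots> = (\<Sum>i=1..n. g (p i) * (w i - w (i - 1)))"
    using sum_by_parts[of "\<lambda>i. g (p i)" w m] ends Suc by (simp add: w_def)
  also have "\<dots> = (\<Sum>i=1..n. g (p i) * (d i * q i - d i * p i))"
    using t s by (intro sum.cong refl) (simp add: w_def flip: t s)
  also have "\<dots> \<le> (\<Sum>i=1..n. d i * f (q i) - d i * f (p i))"
  proof (rule sum_mono)
    fix i assume i: "i \<in> {1..n}"
    then have "d i * (f (p i) + g (p i) * (q i - p i)) \<le> d i * f (q i)"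
      using g[of "p i" "q i"] d by (intro mult_left_mono) auto
    then show "g (p i) * (d i * q i - d i * p i) \<le> d i * f (q i) - d i * f (p i)"
      by (simp add: algebra_simps)
  qed
  finally show ?thesis by (simp add: sum_subtractf)
qed simp

text \<open>Optimality is applied to the distance from \<open>{a..b}\<close> as cost: its total is
  zero along \<open>s\<close>, hence also along \<open>t\<close>, and positive weights
  \<open>d\<close> force every single term to vanish.\<close>

lemma taut_bounds:
  fixes d p q s t :: "nat \<Rightarrow> real"
  assumes d: "\<And>i. i \<in> {1..n} \<Longrightarrow> 0 < d i"
    and t: "\<And>i. i \<in> {1..n} \<Longrightarrow> t i - t (i - 1) = d i * p i"
    and s: "\<And>i. i \<in> {1..n} \<Longrightarrow> s i - s (i - 1) = d i * q i"
    and ends: "s 0 = t 0" "s n = t n"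
    and up: "\<And>i. i \<in> {1..<n} \<Longrightarrow> p i < p (Suc i) \<Longrightarrow> s i \<le> t i"
    and down: "\<And>i. i \<in> {1..<n} \<Longrightarrow> p (Suc i) < p i \<Longrightarrow> t i \<le> s i"
    and q: "\<And>i. i \<in> {1..n} \<Longrightarrow> q i \<in> {a..b}"
    and j: "j \<in> {1..n}"
  shows "p j \<in> {a..b}"
proof -
  \<comment> \<open>This cost vanishes exactly on \<open>{a..b}\<close>.\<close>
  define f where "f x = max 0 (a - x) + max 0 (x - b)" for x
  have hinge: "convex_on UNIV (\<lambda>x. max 0 (m * x + e))" for m e :: real
  proof (rule convex_onI)
    fix u x y :: real assume u: "0 < u" "u < 1"
    have "m * ((1 - u) *\<^sub>R x + u *\<^sub>R y) + e = (1 - u) * (m * x + e) + u * (m * y + e)"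
      by (simp add: algebra_simps)
    also have "\<dots> \<le> (1 - u) * max 0 (m * x + e) + u * max 0 (m * y + e)"
      using u by (intro add_mono mult_left_mono) auto
    finally show "max 0 (m * ((1 - u) *\<^sub>R x + u *\<^sub>R y) + e)
        \<le> (1 - u) * max 0 (m * x + e) + u * max 0 (m * y + e)"
      using u by simp
  qed simp
  have f: "convex_on UNIV f"
    using convex_on_add[OF hinge[of "-1" a] hinge[of 1 "-b"]] by (simp add: f_def[abs_def])
  have "(\<Sum>i=1..n. d i * f (p i)) \<le> (\<Sum>i=1..n. d i * f (q i))"
    by (rule taut_optimal[where t=t and s=s and S=UNIV]) (use assms f in \<open>auto simp: less_imp_le\<close>)
  also have "\<dots> = 0"
    using q by (intro sum.neutral) (auto simp: f_def)
  finally have "(\<Sum>i=1..n. d i * f (p i)) = 0"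
    using d by (intro antisym sum_nonneg) (auto simp: f_def less_imp_le)
  then have "d j * f (p j) = 0"
    using d j by (subst (asm) sum_nonneg_eq_0_iff) (auto simp: f_def less_imp_le)
  then have "f (p j) = 0" using d[OF j] by simp
  then show ?thesis by (auto simp: f_def max_def split: if_splits)
qed

text \<open>Slopes \<open>p = 1 / v\<close> make travel times linear. The cost stays convex in
  \<open>p\<close>, because the reciprocal is convex on the positive reals and \<open>c\<close> is
  convex and non-decreasing.\<close>

lemma convex_on_comp_inverse:
  fixes c :: "real \<Rightarrow> real"
  assumes a: "0 < a" "a \<le> b" and mono: "mono_on {a..b} c" and conv: "convex_on {a..b} c"
  shows "convex_on {1 / b..1 / a} (\<lambda>p. c (1 / p))"
proof (rule convex_onI)
    fix u x y :: real
    assume u: "0 < u" "u < 1" and xy: "x \<in> {1 / b..1 / a}" "y \<in> {1 / b..1 / a}"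
    define z where "z = (1 - u) *\<^sub>R x + u *\<^sub>R y"
    have z: "z \<in> {1 / b..1 / a}"
      unfolding z_def using convexD_alt[OF convex_real_interval(5) xy] u by auto
    have in_ab: "1 / r \<in> {a..b} \<and> 0 < r" if "r \<in> {1 / b..1 / a}" for r
    proof -
      have "0 < 1 / b" using a by simp
      then have "0 < r" using that unfolding atLeastAtMost_iff by linarith
      then show ?thesis using that a by (auto simp: field_simps)
    qed
    have pos: "0 < x" "0 < y" "0 < z" using in_ab xy z by auto
    have inv: "convex_on {0<..} (inverse :: real \<Rightarrow> real)"
      by (rule convex_on_inverse) auto
    have "1 / z \<le> (1 - u) * (1 / x) + u * (1 / y)"
      using convex_onD[OF inv, of u x y] u pos by (simp add: z_def inverse_eq_divide)
    moreover have "(1 - u) * (1 / x) + u * (1 / y) \<in> {a..b}"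
      using convexD_alt[OF convex_real_interval(5), of "1 / x" a b "1 / y" u] in_ab xy u by auto
    ultimately have "c (1 / z) \<le> c ((1 - u) * (1 / x) + u * (1 / y))"
      using in_ab z by (intro mono_onD[OF mono]) auto
    also have "\<dots> \<le> (1 - u) * c (1 / x) + u * c (1 / y)"
      using convex_onD[OF conv, of u "1 / x" "1 / y"] in_ab xy u by auto
    finally show "c (1 / ((1 - u) *\<^sub>R x + u *\<^sub>R y)) \<le> (1 - u) * c (1 / x) + u * c (1 / y)"
      by (simp add: z_def)
qed (rule convex_real_interval)

section \<open>Computing a taut string backwards\<close>

context
  fixes n :: nat and A D d :: "nat \<Rightarrow> real" and te :: real
begin

text \<open>\<open>pos i l\<close> is the time at which the taut string to \<open>te\<close> at node \<open>n\<close> passes node \<open>i\<close> if it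
  arrives there with slope \<open>l\<close>, and \<open>depart i l\<close> the time at which it passes if it leaves with
  slope \<open>l\<close>; the two differ where the string bends.\<close>
function pos :: "nat \<Rightarrow> real \<Rightarrow> real" where
  "pos i l = (if i < n then min (D i) (max (A i) (pos (Suc i) l - d (Suc i) * l)) else te)"
  by auto
termination by (relation "measure (\<lambda>(i, l). n - i)") auto

declare pos.simps [simp del]

definition depart :: "nat \<Rightarrow> real \<Rightarrow> real" where
  "depart i l = pos (Suc i) l - d (Suc i) * l"

lemma pos_antimono:
  assumes "\<And>i. i \<in> {1..n} \<Longrightarrow> 0 < d i" "l \<le> l'"
  shows "pos i l' \<le> pos i l"
  using assms(2)
proof (induction i l rule: pos.induct)
  case (1 i l)
  show ?case
  proof (cases "i < n")
    case True
    then have "pos (Suc i) l' - d (Suc i) * l' \<le> pos (Suc i) l - d (Suc i) * l"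
      using 1 assms(1)[of "Suc i"] by (intro diff_mono mult_left_mono) auto
    then show ?thesis
      using True by (subst (1 2) pos.simps) (auto simp: min_def max_def)
  qed (simp add: pos.simps)
qed

text \<open>Strictness comes from the subtracted term \<open>d (Suc i) * l\<close>; it yields
  \<open>lo i \<le> hi i\<close> in \<open>taut_string\<close>.\<close>

lemma depart_strict_antimono:
  assumes "\<And>i. i \<in> {1..n} \<Longrightarrow> 0 < d i" "i < n" "l < l'"
  shows "depart i l' < depart i l"
proof -
  have "d (Suc i) * l < d (Suc i) * l'"
    using assms by (intro mult_strict_left_mono) auto
  then show ?thesis
    using pos_antimono[OF assms(1), of l l' "Suc i"] assms(3) by (simp add: depart_def)
qed

text \<open>Forward induction identifies \<open>t i\<close> with
  \<open>depart i (lam (Suc i))\<close>. The slope changes at a node only when the clamp is active,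
  and then the departure time is the window end that belongs to \<open>lo i\<close> or
  \<open>hi i\<close>.\<close>

lemma taut_string:
  assumes n: "0 < n" and d: "\<And>i. i \<in> {1..n} \<Longrightarrow> 0 < d i"
    and AD: "\<And>i. i < n \<Longrightarrow> A i \<le> D i" "A 0 = D 0"
    and roots: "\<And>i. i < n \<Longrightarrow> depart i (lo i) = D i \<and> depart i (hi i) = A i"
    and lam: "\<And>i. i < n \<Longrightarrow> lam (Suc i) =
      (if lam i < lo i then lo i else if hi i < lam i then hi i else lam i)"
    and t0: "t 0 = A 0"
    and t: "\<And>i. i < n \<Longrightarrow> t (Suc i) = t i + d (Suc i) * lam (Suc i)"
  shows "t n = te"
    and "\<And>i. i < n \<Longrightarrow> A i \<le> t i \<and> t i \<le> D i"
    and "\<And>i. 0 < i \<Longrightarrow> i < n \<Longrightarrow> lam i < lam (Suc i) \<Longrightarrow> t i = D i"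
    and "\<And>i. 0 < i \<Longrightarrow> i < n \<Longrightarrow> lam (Suc i) < lam i \<Longrightarrow> t i = A i"
proof -
  have anti: "depart i l' \<le> depart i l" if "i < n" "l \<le> l'" for i l l'
    using depart_strict_antimono[OF d, of i l l'] that by (cases "l = l'") auto
  have lohi: "lo i \<le> hi i" if "i < n" for i
    using depart_strict_antimono[OF d, of i "hi i" "lo i"] roots[of i] AD(1)[of i] that by force
  \<comment> \<open>As \<open>depart i\<close> is decreasing, clamping the slope to
    \<open>[lo i, hi i]\<close> amounts to clipping the departure time to \<open>[A i, D i]\<close>,
    which is exactly what \<open>pos i\<close> does.\<close>
  have clip: "depart i (lam (Suc i)) = min (D i) (max (A i) (depart i (lam i)))" if "i < n" for i
    using that roots[OF that] lam[OF that] lohi[OF that] AD(1)[OF that]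
      anti[OF that, of "lam i" "lo i"] anti[OF that, of "hi i" "lam i"]
      anti[OF that, of "lam i" "hi i"] anti[OF that, of "lo i" "lam i"]
    by (auto simp: min_def max_def)
  have step: "t (Suc i) = pos (Suc i) (lam (Suc i))" if "i < n" "t i = depart i (lam (Suc i))" for i
    using that t by (simp add: depart_def)
  have depart: "t i = depart i (lam (Suc i))" if "i < n" for i
    using that
  proof (induction i)
    case 0
    \<comment> \<open>Since \<open>A 0 = D 0\<close>, clipping yields \<open>A 0\<close> for every
      value of \<open>lam 0\<close>, so the slope before the first node may be arbitrary.\<close>
    then show ?case using clip[of 0] AD t0 by (auto simp: min_def max_def)
  next
    case (Suc i)
    then show ?case using step[of i] clip[of "Suc i"]
      by (simp add: depart_def pos.simps[of "Suc i"])
  qed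
  show "t n = te"
    using n step[of "n - 1"] depart[of "n - 1"] by (simp add: pos.simps)
  show "A i \<le> t i \<and> t i \<le> D i" if "i < n" for i
    using clip[OF that] depart[OF that] AD(1)[OF that] by (auto simp: min_def max_def)
  show "t i = D i" if "0 < i" "i < n" "lam i < lam (Suc i)" for i
    using depart[of i] lam[of i] lohi[of i] roots[of i] that by (auto split: if_splits)
  show "t i = A i" if "0 < i" "i < n" "lam (Suc i) < lam i" for i
    using depart[of i] lam[of i] lohi[of i] roots[of i] that by (auto split: if_splits)
qed

end

section \<open>Piecewise linear functions in a deque\<close>

text \<open>Piece \<open>k\<close> of \<open>f\<close> is the line \<open>l \<mapsto> T k - (x - X k) * l\<close> between the breakpoints \<open>b (k - 1)\<close>
  and \<open>b k\<close>; subtracting a linear function from \<open>f\<close> only changes \<open>x\<close>.\<close>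

definition pieces :: "nat \<Rightarrow> nat \<Rightarrow> (nat \<Rightarrow> real) \<Rightarrow> (nat \<Rightarrow> real) \<Rightarrow> (nat \<Rightarrow> real) \<Rightarrow> real \<Rightarrow>
    (real \<Rightarrow> real) \<Rightarrow> bool" where
  "pieces L R T X b x f \<longleftrightarrow> L \<le> R \<and> (\<forall>k. L \<le> k \<and> k \<le> R \<longrightarrow> X k \<le> x) \<and>
     (\<forall>j k. L \<le> j \<and> j \<le> k \<and> k < R \<longrightarrow> b j \<le> b k) \<and>
     (\<forall>k l. L \<le> k \<and> k \<le> R \<and> (L < k \<longrightarrow> b (k - 1) \<le> l) \<and> (k < R \<longrightarrow> l \<le> b k) \<longrightarrow>
        f l = T k - (x - X k) * l)"

text \<open>Passing a leg only increases \<open>x\<close>, so it takes constant time for the whole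
  deque. Afterwards all pieces are strictly decreasing, and their roots can be found by
  division.\<close>

lemma pieces_shift:
  assumes "pieces L R T X b x f" "0 < e"
  shows "pieces L R T X b (x + e) (\<lambda>l. f l - e * l)"
    and "\<And>k. L \<le> k \<Longrightarrow> k \<le> R \<Longrightarrow> X k < x + e"
  using assms unfolding pieces_def by (fastforce simp: algebra_simps)+

text \<open>\<open>popped\<close> and \<open>stop\<close> place the root \<open>h\<close> of
  \<open>g = a\<close> between the breakpoints of piece \<open>r\<close>. Beyond \<open>h\<close>
  the maximum is constant; this is piece \<open>Suc r\<close>, whose entry \<open>X = x\<close>
  makes its coefficient zero.\<close>

lemma pieces_cut_above:
  assumes P: "pieces L R T X b x g"
    and X: "\<And>k. L \<le> k \<Longrightarrow> k \<le> R \<Longrightarrow> X k < x"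
    and g: "\<And>l l'. l \<le> l' \<Longrightarrow> g l' \<le> g l"
    and r: "L \<le> r" "r \<le> R"
    and popped: "r < R \<Longrightarrow> T (Suc r) - (x - X (Suc r)) * b r < a"
    and stop: "L < r \<Longrightarrow> a \<le> T r - (x - X r) * b (r - 1)"
    and h: "h = (T r - a) / (x - X r)"
  shows "g h = a"
    and "pieces L (Suc r) (T(Suc r := a)) (X(Suc r := x)) (b(r := h)) x (\<lambda>l. max a (g l))"
proof -
  have b: "b j \<le> b k" if "L \<le> j" "j \<le> k" "k < R" for j k
    using P that by (auto simp: pieces_def)
  have val: "g l = T k - (x - X k) * l"
    if "L \<le> k" "k \<le> R" "L < k \<Longrightarrow> b (k - 1) \<le> l" "k < R \<Longrightarrow> l \<le> b k" for k l
    using P that by (auto simp: pieces_def)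
  have Xr: "0 < x - X r" using X r by simp
  have at_h: "T r - (x - X r) * h = a" using Xr by (simp add: h)
  have lower: "b (r - 1) \<le> h" if "L < r"
    using stop[OF that] at_h Xr by (smt (verit) mult_less_cancel_left_pos)
  have upper: "h \<le> b r" if "r < R"
  proof -
    \<comment> \<open>Neighbouring pieces agree at their common breakpoint, so the test that removed
      piece \<open>Suc r\<close> also bounds piece \<open>r\<close> there.\<close>
    have "g (b r) = T (Suc r) - (x - X (Suc r)) * b r"
      using that r by (intro val b) auto
    moreover have "g (b r) = T r - (x - X r) * b r"
      using that r by (intro val b) auto
    ultimately have "T r - (x - X r) * b r < a"
      using popped[OF that] by simp
    then show ?thesis using at_h Xr by (smt (verit) mult_less_cancel_left_pos)
  qed
  show gh: "g h = a"
    using val[of r h] r lower upper at_h by simp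
  have below: "b k \<le> h" if "L \<le> k" "k < r" for k
    using b[of k "r - 1"] that r lower by force
  have big: "a \<le> g l" if "l \<le> h" for l using g[OF that] gh by simp
  show "pieces L (Suc r) (T(Suc r := a)) (X(Suc r := x)) (b(r := h)) x (\<lambda>l. max a (g l))"
    unfolding pieces_def
  proof (intro conjI allI impI; (elim conjE)?)
    fix k assume "L \<le> k" "k \<le> Suc r"
    then show "(X(Suc r := x)) k \<le> x" using X[of k] r by auto
  next
    fix j k assume "L \<le> j" "j \<le> k" "k < Suc r"
    then show "(b(r := h)) j \<le> (b(r := h)) k" using b[of j k] below r by auto
  next
    fix k l
    assume k: "L \<le> k" "k \<le> Suc r" and *: "L < k \<longrightarrow> (b(r := h)) (k - 1) \<le> l"
      "k < Suc r \<longrightarrow> l \<le> (b(r := h)) k"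
    consider "k < r" | "k = r" | "k = Suc r" using k by linarith
    then show "max a (g l) = (T(Suc r := a)) k - (x - (X(Suc r := x)) k) * l"
    proof cases
      case 1
      then have "l \<le> b k" using * by simp
      then have "l \<le> h" using below[of k] 1 k by simp
      then show ?thesis using big[of l] val[of k l] k * 1 r by (auto split: if_splits)
    next
      case 2
      then have "l \<le> h" using * by simp
      moreover have "g l = T r - (x - X r) * l"
        using r * 2 upper \<open>l \<le> h\<close> by (intro val) (auto split: if_splits)
      ultimately show ?thesis using big[of l] 2 by simp
    next
      case 3
      then have "h \<le> l" using * r by auto
      then show ?thesis using g[of h l] gh 3 by simp
    qed
  qed (use r in auto)
qed

text \<open>Mirror image of the previous cut, with the constant piece added on the left at
  \<open>r - 1\<close>. The last piece may already be constant; \<open>last\<close> makes the search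
  stop before it, so that the root is never computed with a zero divisor.\<close>

lemma pieces_cut_below:
  assumes P: "pieces L R T X b x g"
    and X: "\<And>k. L \<le> k \<Longrightarrow> k < R \<Longrightarrow> X k < x"
    and g: "\<And>l l'. l \<le> l' \<Longrightarrow> g l' \<le> g l"
    and last: "L < R" "g (b (R - 1)) \<le> a"
    and r: "L \<le> r" "r \<le> R" "0 < r"
    and popped: "L < r \<Longrightarrow> a < T (r - 1) - (x - X (r - 1)) * b (r - 1)"
    and stop: "r < R \<Longrightarrow> T r - (x - X r) * b r \<le> a"
    and h: "h = (T r - a) / (x - X r)"
  shows "g h = a" "h \<le> b (R - 1)" "r < R"
    and "pieces (r - 1) R (T(r - 1 := a)) (X(r - 1 := x)) (b(r - 1 := h)) x (\<lambda>l. min a (g l))"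
proof -
  have b: "b j \<le> b k" if "L \<le> j" "j \<le> k" "k < R" for j k
    using P that by (auto simp: pieces_def)
  have val: "g l = T k - (x - X k) * l"
    if "L \<le> k" "k \<le> R" "L < k \<Longrightarrow> b (k - 1) \<le> l" "k < R \<Longrightarrow> l \<le> b k" for k l
    using P that by (auto simp: pieces_def)
  have prev: "a < g (b (r - 1))" if "L < r"
    using popped[OF that] val[of "r - 1" "b (r - 1)"] that r b by force
  \<comment> \<open>Reaching \<open>R\<close> would mean that \<open>g\<close> exceeds
    \<open>a\<close> at the last breakpoint, against \<open>last\<close>.\<close>
  show rR: "r < R"
    using prev last r by (cases "r = R") auto
  have Xr: "0 < x - X r" using X r rR by simp
  have at_h: "T r - (x - X r) * h = a" using Xr by (simp add: h)
  have upper: "h \<le> b r"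
    using stop[OF rR] at_h Xr by (smt (verit) mult_less_cancel_left_pos)
  have lower: "b (r - 1) \<le> h" if "L < r"
  proof -
    have "g (b (r - 1)) = T r - (x - X r) * b (r - 1)"
      using that r rR by (intro val b) auto
    then show ?thesis
      using prev[OF that] at_h Xr by (smt (verit) mult_less_cancel_left_pos)
  qed
  show gh: "g h = a"
    using val[of r h] r lower upper at_h by simp
  have above: "h \<le> b k" if "r \<le> k" "k < R" for k
    using b[of r k] that r upper by simp
  then show "h \<le> b (R - 1)" using rR by simp
  have small: "g l \<le> a" if "h \<le> l" for l using g[OF that] gh by simp
  show "pieces (r - 1) R (T(r - 1 := a)) (X(r - 1 := x)) (b(r - 1 := h)) x (\<lambda>l. min a (g l))"
    unfolding pieces_def
  proof (intro conjI allI impI; (elim conjE)?)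
    fix k assume "r - 1 \<le> k" "k \<le> R"
    then show "(X(r - 1 := x)) k \<le> x" using P r by (auto simp: pieces_def)
  next
    fix j k assume "r - 1 \<le> j" "j \<le> k" "k < R"
    then show "(b(r - 1 := h)) j \<le> (b(r - 1 := h)) k" using b[of j k] above[of k] r by auto
  next
    fix k l
    assume k: "r - 1 \<le> k" "k \<le> R" and *: "r - 1 < k \<longrightarrow> (b(r - 1 := h)) (k - 1) \<le> l"
      "k < R \<longrightarrow> l \<le> (b(r - 1 := h)) k"
    consider "r < k" | "k = r" | "k = r - 1" "k \<noteq> r" using k by linarith
    then show "min a (g l) = (T(r - 1 := a)) k - (x - (X(r - 1 := x)) k) * l"
    proof cases
      case 1
      then have "b (k - 1) \<le> l" using * r by (auto split: if_splits)
      moreover have "h \<le> b (k - 1)" using 1 k by (intro above) auto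
      ultimately have "h \<le> l" by simp
      then show ?thesis using small[of l] val[of k l] k * 1 r \<open>b (k - 1) \<le> l\<close>
        by (auto split: if_splits)
    next
      case 2
      then have "h \<le> l" using * r by auto
      moreover have "g l = T r - (x - X r) * l"
        using r * 2 lower \<open>h \<le> l\<close> by (intro val) (auto split: if_splits)
      moreover have "r \<noteq> r - 1" using r by simp
      ultimately show ?thesis using small[of l] 2 by simp
    next
      case 3
      then have "l \<le> h" using * r rR by auto
      then show ?thesis using g[of l h] gh 3 by simp
    qed
  qed (use r in auto)
qed

section \<open>Reasoning about programs\<close>

text \<open>The second argument of a postcondition is what is left of the time budget.\<close>
definition wp :: "(real \<Rightarrow> real) \<Rightarrow> com \<Rightarrow> (store \<Rightarrow> nat \<Rightarrow> bool) \<Rightarrow> store \<Rightarrow> nat \<Rightarrow> bool" where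
  "wp c P Q s m \<longleftrightarrow> (\<exists>k s'. exec c P s k s' \<and> k \<le> m \<and> Q s' (m - k))"

inductive_cases exec_SkipE: "exec c Skip s k s'"
inductive_cases exec_NSetE: "exec c (NSet x e f) s k s'"
inductive_cases exec_RSetE: "exec c (RSet x e f) s k s'"
inductive_cases exec_SeqE: "exec c (Seq P P') s k s'"
inductive_cases exec_IfE: "exec c (If b P P') s k s'"

lemma wp_Skip: "wp c Skip Q s m \<longleftrightarrow> 1 \<le> m \<and> Q s (m - 1)"
  unfolding wp_def by (metis exec.Skip exec_SkipE)

lemma wp_NSet: "wp c (NSet x e f) Q s m \<longleftrightarrow>
    1 + ncost e + ncost f \<le> m \<and> Q (nset x (nval e s) (nval f s) s) (m - (1 + ncost e + ncost f))"
  unfolding wp_def by (metis exec.NSet exec_NSetE)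

lemma wp_RSet: "wp c (RSet x e f) Q s m \<longleftrightarrow>
    1 + ncost e + rcost f \<le> m \<and> Q (rset x (nval e s) (rval c f s) s) (m - (1 + ncost e + rcost f))"
  unfolding wp_def by (metis exec.RSet exec_RSetE)

lemma wp_Seq: "wp c (Seq P P') Q s m \<longleftrightarrow> wp c P (wp c P' Q) s m"
proof
  assume "wp c (Seq P P') Q s m"
  then obtain k l s' s'' where *: "exec c P s k s'" "exec c P' s' l s''" "k + l \<le> m"
      "Q s'' (m - (k + l))"
    unfolding wp_def by (blast elim: exec_SeqE)
  then show "wp c P (wp c P' Q) s m"
    unfolding wp_def by (intro exI[of _ k] exI[of _ s'] exI[of _ l] exI[of _ s''] conjI) auto
next
  assume "wp c P (wp c P' Q) s m"
  then obtain k s' l s'' where "exec c P s k s'" "k \<le> m" "exec c P' s' l s''" "l \<le> m - k"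
      "Q s'' (m - k - l)"
    unfolding wp_def by blast
  then show "wp c (Seq P P') Q s m"
    unfolding wp_def by (intro exI[of _ "k + l"] exI[of _ s''] conjI exec.Seq) auto
qed

lemma wp_If: "wp c (If b P P') Q s m \<longleftrightarrow> 1 + bcost b \<le> m \<and>
    (if bval c b s then wp c P Q s (m - (1 + bcost b)) else wp c P' Q s (m - (1 + bcost b)))"
proof
  assume "wp c (If b P P') Q s m"
  then show "1 + bcost b \<le> m \<and>
    (if bval c b s then wp c P Q s (m - (1 + bcost b)) else wp c P' Q s (m - (1 + bcost b)))"
    unfolding wp_def by (fastforce elim: exec_IfE)
next
  assume *: "1 + bcost b \<le> m \<and>
    (if bval c b s then wp c P Q s (m - (1 + bcost b)) else wp c P' Q s (m - (1 + bcost b)))"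
  define B where "B = (if bval c b s then P else P')"
  from * obtain k s' where "exec c B s k s'" "k \<le> m - (1 + bcost b)" "Q s' (m - (1 + bcost b) - k)"
    unfolding wp_def B_def by (auto split: if_splits)
  with * show "wp c (If b P P') Q s m"
    unfolding wp_def B_def
    by (intro exI[of _ "1 + bcost b + k"] exI[of _ s'])
      (auto split: if_splits intro: exec.IfTrue[simplified] exec.IfFalse[simplified])
qed

text \<open>The last rule keeps running times from being computed in unary.\<close>
lemmas wp_simps = wp_Skip wp_NSet wp_RSet wp_Seq wp_If numeral_2_eq_2 [symmetric]

lemma wp_mono: "wp c P Q s m \<Longrightarrow> (\<And>s' m'. Q s' m' \<Longrightarrow> Q' s' m') \<Longrightarrow> wp c P Q' s m"
  unfolding wp_def by blast

text \<open>Every iteration uses up time, so the budget is also the termination measure.\<close>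
lemma wp_While:
  assumes "Inv s m"
    and step: "\<And>s m. Inv s m \<Longrightarrow> 1 + bcost b \<le> m \<and>
      (if bval c b s then wp c P Inv s (m - (1 + bcost b)) else Q s (m - (1 + bcost b)))"
  shows "wp c (While b P) Q s m"
  using assms(1)
proof (induction m arbitrary: s rule: less_induct)
  case (less m)
  note * = step[OF less.prems]
  show ?case
  proof (cases "bval c b s")
    case True
    then obtain k s' where 1: "exec c P s k s'" "k \<le> m - (1 + bcost b)"
        "Inv s' (m - (1 + bcost b) - k)"
      using * unfolding wp_def by auto
    moreover have "m - (1 + bcost b) - k < m" using * by simp
    ultimately obtain l s'' where "exec c (While b P) s' l s''" "l \<le> m - (1 + bcost b) - k"
        "Q s'' (m - (1 + bcost b) - k - l)"
      using less.IH unfolding wp_def by blast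
    then show ?thesis
      using exec.WhileTrue[OF True 1(1)] 1(2) * unfolding wp_def
      by (intro exI[of _ "1 + bcost b + k + l"] exI[of _ s'']) auto
  next
    case False
    then show ?thesis
      using exec.WhileFalse[OF False] * unfolding wp_def
      by (intro exI[of _ "1 + bcost b"] exI[of _ s]) auto
  qed
qed

lemma nset_sel [simp]:
  "nats (nset x i a s) = (nats s)(x := (nats s x)(i := a))" "reals (nset x i a s) = reals s"
  by (simp_all add: nset_def)

lemma rset_sel [simp]:
  "reals (rset x i a s) = (reals s)(x := (reals s x)(i := a))" "nats (rset x i a s) = nats s"
  by (simp_all add: rset_def)

lemma nset_nset [simp]: "nset x i a (nset x i b s) = nset x i a s"
  by (simp add: nset_def)

lemma rset_rset [simp]: "rset x i a (rset x i b s) = rset x i a s"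
  by (simp add: rset_def)

lemma nset_same [simp]: "nset x i (nats s x i) s = s"
  by (simp add: nset_def)

section \<open>The algorithm\<close>

abbreviation N :: "name \<Rightarrow> nexp" where "N x \<equiv> NGet x (NConst 0)"
abbreviation V :: "name \<Rightarrow> rexp" where "V x \<equiv> RGet x (NConst 0)"
abbreviation nassign :: "name \<Rightarrow> nexp \<Rightarrow> com" where "nassign x e \<equiv> NSet x (NConst 0) e"
abbreviation rassign :: "name \<Rightarrow> rexp \<Rightarrow> com" where "rassign x e \<equiv> RSet x (NConst 0) e"
abbreviation seq (infixr ";;" 60) where "P ;; Q \<equiv> Seq P Q"
abbreviation inc :: "nexp \<Rightarrow> nexp" where "inc e \<equiv> NAdd e (NConst 1)"
abbreviation dec :: "nexp \<Rightarrow> nexp" where "dec e \<equiv> NSub e (NConst 1)"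

abbreviation line_at :: "nexp \<Rightarrow> rexp \<Rightarrow> rexp" where
  "line_at k l \<equiv> RSub (RGet ''T'' k) (RMul (RSub (V ''x'') (RGet ''X'' k)) l)"
abbreviation line_root :: "nexp \<Rightarrow> rexp \<Rightarrow> rexp" where
  "line_root k a \<equiv> RDiv (RSub (RGet ''T'' k) a) (RSub (V ''x'') (RGet ''X'' k))"

text \<open>A piece is dropped when even its largest value, taken at its left breakpoint, is below
  the opening time.\<close>

definition pop_above :: com where
  "pop_above = While (And (NLess (N ''L'') (N ''R''))
      (RLess (line_at (N ''R'') (RGet ''b'' (dec (N ''R'')))) (RGet ''A'' (N ''i''))))
    (nassign ''R'' (dec (N ''R'')))"

text \<open>A piece is dropped when even its smallest value, taken at its right breakpoint, is above
  the deadline.\<close>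

definition pop_below :: com where
  "pop_below = While (And (NLess (N ''L'') (N ''R''))
      (RLess (RGet ''E'' (N ''i'')) (line_at (N ''L'') (RGet ''b'' (N ''L'')))))
    (nassign ''L'' (inc (N ''L'')))"

definition push_above :: com where
  "push_above =
    RSet ''hi'' (N ''i'') (line_root (N ''R'') (RGet ''A'' (N ''i''))) ;;
    RSet ''b'' (N ''R'') (RGet ''hi'' (N ''i'')) ;;
    nassign ''R'' (inc (N ''R'')) ;;
    RSet ''T'' (N ''R'') (RGet ''A'' (N ''i'')) ;;
    RSet ''X'' (N ''R'') (V ''x'')"

definition push_below :: com where
  "push_below =
    RSet ''lo'' (N ''i'') (line_root (N ''L'') (RGet ''E'' (N ''i''))) ;;
    nassign ''L'' (dec (N ''L'')) ;;
    RSet ''b'' (N ''L'') (RGet ''lo'' (N ''i'')) ;;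
    RSet ''T'' (N ''L'') (RGet ''E'' (N ''i'')) ;;
    RSet ''X'' (N ''L'') (V ''x'')"

text \<open>An empty window is replaced by a single point, so that this phase needs no case distinction;
  the deadlines are compared with the original windows in \<open>check\<close>.\<close>
definition widen :: com where
  "widen = If (RLess (RGet ''D'' (N ''i'')) (RGet ''A'' (N ''i'')))
     (RSet ''E'' (N ''i'') (RGet ''A'' (N ''i'')))
     (RSet ''E'' (N ''i'') (RGet ''D'' (N ''i'')))"

definition backward_step :: com where
  "backward_step =
    rassign ''x'' (RAdd (V ''x'') (RGet ''d'' (N ''i''))) ;;
    nassign ''i'' (dec (N ''i'')) ;;
    widen ;; pop_above ;; push_above ;; pop_below ;; push_below"

definition backward :: com where
  "backward = While (NLess (NConst 0) (N ''i'')) backward_step"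

definition clamp :: com where
  "clamp =
    RSet ''lam'' (inc (N ''i'')) (RGet ''lam'' (N ''i'')) ;;
    If (RLess (RGet ''lam'' (N ''i'')) (RGet ''lo'' (N ''i'')))
      (RSet ''lam'' (inc (N ''i'')) (RGet ''lo'' (N ''i'')))
      (If (RLess (RGet ''hi'' (N ''i'')) (RGet ''lam'' (N ''i'')))
        (RSet ''lam'' (inc (N ''i'')) (RGet ''hi'' (N ''i''))) Skip)"

text \<open>Opening times and the arrival at node \<open>n\<close> are not tested: the computed
  string always meets them.\<close>

definition check :: com where
  "check =
    If (And (Not (RLess (RGet ''D'' (N ''i'')) (RGet ''t'' (N ''i''))))
         (And (Not (RLess (RGet ''v'' (N ''i'')) (V ''v_min'')))
              (Not (RLess (V ''v_max'') (RGet ''v'' (N ''i''))))))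
       Skip (nassign ''feasible'' (NConst 0))"

text \<open>A slope that is zero or negative yields a speed of at most \<open>0\<close> (with
  \<open>1 / 0 = 0\<close>), which is below \<open>v_min\<close> and hence rejected by
  \<open>check\<close>.\<close>

definition forward_step :: com where
  "forward_step =
    clamp ;;
    RSet ''t'' (inc (N ''i'')) (RAdd (RGet ''t'' (N ''i''))
      (RMul (RGet ''d'' (inc (N ''i''))) (RGet ''lam'' (inc (N ''i''))))) ;;
    RSet ''v'' (inc (N ''i'')) (RDiv (RConst 1) (RGet ''lam'' (inc (N ''i'')))) ;;
    nassign ''i'' (inc (N ''i'')) ;;
    check"

definition forward :: com where
  "forward = While (NLess (N ''i'') (N ''n'')) forward_step"

text \<open>Node \<open>0\<close> becomes a window containing only the start time, and \<open>check\<close> also reads a deadline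
  at node \<open>n\<close>.\<close>
definition program :: com where
  "program =
    nassign ''i'' (N ''n'') ;; nassign ''L'' (N ''n'') ;; nassign ''R'' (N ''n'') ;;
    RSet ''A'' (NConst 0) (V ''t_start'') ;;
    RSet ''D'' (NConst 0) (V ''t_start'') ;;
    RSet ''D'' (N ''n'') (V ''t_end'') ;;
    RSet ''T'' (N ''n'') (V ''t_end'') ;;
    backward ;;
    nassign ''i'' (NConst 0) ;;
    nassign ''feasible'' (NConst 1) ;;
    rassign ''t'' (V ''t_start'') ;;
    forward"

section \<open>Effect and running time of the backward phase\<close>

text \<open>The loop ends at an index \<open>r\<close> with the two inequalities that
  \<open>pieces_cut_above\<close> requires as \<open>popped\<close> and \<open>stop\<close>. Each
  pop, including its test, fits into 40 units.\<close>

lemma wp_pop_above: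
  fixes s :: store
  defines "L \<equiv> nats s ''L'' 0" and "R \<equiv> nats s ''R'' 0" and "b \<equiv> reals s ''b''"
    and "a \<equiv> reals s ''A'' (nats s ''i'' 0)"
    and "seg \<equiv> \<lambda>k l. reals s ''T'' k - (reals s ''x'' 0 - reals s ''X'' k) * l"
  assumes "L \<le> R" "40 * (R - L) + 40 \<le> m"
    and Q: "\<And>r m'. L \<le> r \<Longrightarrow> r \<le> R \<Longrightarrow> (r < R \<Longrightarrow> seg (Suc r) (b r) < a) \<Longrightarrow>
      (L < r \<Longrightarrow> a \<le> seg r (b (r - 1))) \<Longrightarrow> m \<le> m' + 40 * (R - r) + 40 \<Longrightarrow> Q (nset ''R'' 0 r s) m'"
  shows "wp c pop_above Q s m"
  unfolding pop_above_def
proof (rule wp_While[where Inv = "\<lambda>s' m'. \<exists>r. s' = nset ''R'' 0 r s \<and> L \<le> r \<and> r \<le> R \<and>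
    (r < R \<longrightarrow> seg (Suc r) (b r) < a) \<and> m \<le> m' + 40 * (R - r) \<and> 40 * (r - L) + 40 \<le> m'"],
    goal_cases)
  case 1
  show ?case using assms by (intro exI[of _ R]) (auto simp: R_def)
next
  case (2 s' m')
  then obtain r where r: "s' = nset ''R'' 0 r s" "L \<le> r" "r \<le> R"
    "r < R \<longrightarrow> seg (Suc r) (b r) < a" "m \<le> m' + 40 * (R - r)" "40 * (r - L) + 40 \<le> m'"
    by blast
  show ?case
  proof (cases "L < r \<and> seg r (b (r - 1)) < a")
    case True
    then show ?thesis using r
      by (auto simp: wp_simps L_def R_def b_def a_def seg_def intro!: exI[of _ "r - 1"])
  next
    case False
    \<comment> \<open>27 units pay for the final, failing loop test.\<close>
    then show ?thesis using r Q[of r "m' - 27"]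
      by (auto simp: wp_simps L_def R_def b_def a_def seg_def)
  qed
qed

lemma wp_pop_below:
  fixes s :: store
  defines "L \<equiv> nats s ''L'' 0" and "R \<equiv> nats s ''R'' 0" and "b \<equiv> reals s ''b''"
    and "a \<equiv> reals s ''E'' (nats s ''i'' 0)"
    and "seg \<equiv> \<lambda>k l. reals s ''T'' k - (reals s ''x'' 0 - reals s ''X'' k) * l"
  assumes "L \<le> R" "40 * (R - L) + 40 \<le> m"
    and Q: "\<And>r m'. L \<le> r \<Longrightarrow> r \<le> R \<Longrightarrow> (L < r \<Longrightarrow> a < seg (r - 1) (b (r - 1))) \<Longrightarrow>
      (r < R \<Longrightarrow> seg r (b r) \<le> a) \<Longrightarrow> m \<le> m' + 40 * (r - L) + 40 \<Longrightarrow> Q (nset ''L'' 0 r s) m'"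
  shows "wp c pop_below Q s m"
  unfolding pop_below_def
proof (rule wp_While[where Inv = "\<lambda>s' m'. \<exists>r. s' = nset ''L'' 0 r s \<and> L \<le> r \<and> r \<le> R \<and>
    (L < r \<longrightarrow> a < seg (r - 1) (b (r - 1))) \<and> m \<le> m' + 40 * (r - L) \<and> 40 * (R - r) + 40 \<le> m'"],
    goal_cases)
  case 1
  show ?case using assms by (intro exI[of _ L]) (auto simp: L_def)
next
  case (2 s' m')
  then obtain r where r: "s' = nset ''L'' 0 r s" "L \<le> r" "r \<le> R"
    "L < r \<longrightarrow> a < seg (r - 1) (b (r - 1))" "m \<le> m' + 40 * (r - L)" "40 * (R - r) + 40 \<le> m'"
    by blast
  show ?case
  proof (cases "r < R \<and> a < seg r (b r)")
    case True
    then show ?thesis using r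
      by (auto simp: wp_simps L_def R_def b_def a_def seg_def intro!: exI[of _ "Suc r"])
  next
    case False
    then show ?thesis using r Q[of r "m' - 25"]
      by (auto simp: wp_simps L_def R_def b_def a_def seg_def)
  qed
qed

lemma wp_widen: "wp c widen Q s m \<longleftrightarrow> 14 \<le> m \<and>
    (let i = nats s ''i'' 0 in
      Q (rset ''E'' i (max (reals s ''A'' i) (reals s ''D'' i)) s) (m - 14))"
  by (auto simp: widen_def wp_simps Let_def max_def)

definition unchanged :: "name set \<Rightarrow> store \<Rightarrow> store \<Rightarrow> bool" where
  "unchanged S s0 s \<longleftrightarrow> nats s ''n'' = nats s0 ''n'' \<and> (\<forall>x\<in>S. reals s x = reals s0 x)"

text \<open>The deque represents \<open>pos\<close> at the current node for the widened windows. The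
  clause \<open>i \<le> L\<close> leaves room for the pushes on the left, so that decrementing
  \<open>L\<close> is never truncated at 0.\<close>

definition backward_inv :: "store \<Rightarrow> store \<Rightarrow> bool" where
  "backward_inv s0 s \<longleftrightarrow>
    (let n = nats s0 ''n'' 0; A = reals s0 ''A''; E = \<lambda>k. max (A k) (reals s0 ''D'' k);
      d = reals s0 ''d''; te = reals s0 ''t_end'' 0; i = nats s ''i'' 0; L = nats s ''L'' 0
     in unchanged {''A'', ''D'', ''d'', ''v_min'', ''v_max'', ''t_start''} s0 s \<and> i \<le> n \<and> i \<le> L \<and>
      pieces L (nats s ''R'' 0) (reals s ''T'') (reals s ''X'') (reals s ''b'') (reals s ''x'' 0)
        (pos n A E d te i) \<and>
      (\<forall>k. i \<le> k \<and> k < n \<longrightarrow> depart n A E d te k (reals s ''lo'' k) = E k \<and>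
        depart n A E d te k (reals s ''hi'' k) = A k))"

text \<open>The maximum with the opening time is taken first and gives \<open>hi\<close>, then the
  minimum with the deadline gives \<open>lo\<close>. The 300 units cover the fixed work and 80 units
  of potential for the two pushed pieces.\<close>

lemma wp_backward_step:
  assumes inv: "backward_inv s0 s" and i: "0 < nats s ''i'' 0"
    and d: "\<And>i. i \<in> {1..nats s0 ''n'' 0} \<Longrightarrow> 0 < reals s0 ''d'' i"
    and m: "40 * (nats s ''R'' 0 - nats s ''L'' 0) + 300 \<le> m"
  shows "wp c backward_step
    (\<lambda>s' m'. backward_inv s0 s' \<and> Suc (nats s' ''i'' 0) = nats s ''i'' 0 \<and>
      40 * (nats s' ''R'' 0 - nats s' ''L'' 0) + m \<le> m' + 40 * (nats s ''R'' 0 - nats s ''L'' 0) + 300)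
    s m" (is "wp c _ ?Q s m")
proof -
  define n A D dd te where "n = nats s0 ''n'' 0" and "A = reals s0 ''A''" and "D = reals s0 ''D''"
    and "dd = reals s0 ''d''" and "te = reals s0 ''t_end'' 0"
  define E where "E = (\<lambda>k. max (A k) (D k))"
  define j where "j = nats s ''i'' 0 - 1"
  define L R where "L = nats s ''L'' 0" and "R = nats s ''R'' 0"
  define T X b where "T = reals s ''T''" and "X = reals s ''X''" and "b = reals s ''b''"
  define x where "x = reals s ''x'' 0 + dd (Suc j)"
  define G where "G = depart n A E dd te j"
  have ij: "nats s ''i'' 0 = Suc j" using i by (simp add: j_def)
  have inv': "unchanged {''A'', ''D'', ''d'', ''v_min'', ''v_max'', ''t_start''} s0 s" "Suc j \<le> n" "Suc j \<le> L"
      "pieces L R T X b (reals s ''x'' 0) (pos n A E dd te (Suc j))"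
      "\<And>k. Suc j \<le> k \<Longrightarrow> k < n \<Longrightarrow> depart n A E dd te k (reals s ''lo'' k) = E k \<and>
        depart n A E dd te k (reals s ''hi'' k) = A k"
    using inv unfolding backward_inv_def Let_def ij
    by (auto simp: n_def A_def D_def dd_def te_def E_def L_def R_def T_def X_def b_def)
  have same: "reals s ''A'' = A" "reals s ''D'' = D" "reals s ''d'' = dd"
    using inv'(1) by (auto simp: unchanged_def A_def D_def dd_def)
  have pos: "pos n A E dd te j = (\<lambda>l. min (E j) (max (A j) (G l)))"
    using inv'(2) by (auto simp: pos.simps[of _ _ _ _ _ j] G_def depart_def)
  have anti: "G l' \<le> G l" if "l \<le> l'" for l l'
    using depart_strict_antimono[of n dd j l l' A E te] d that inv'(2)
    by (cases "l = l'") (auto simp: G_def n_def dd_def)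
  have dj: "0 < dd (Suc j)" using d inv'(2) by (auto simp: dd_def n_def)
  have G: "pieces L R T X b x G" and Xx: "\<And>k. L \<le> k \<Longrightarrow> k \<le> R \<Longrightarrow> X k < x"
    using pieces_shift[OF inv'(4) dj] by (auto simp: x_def G_def depart_def[abs_def])
  have LR: "L \<le> R" using G by (simp add: pieces_def)
  define s1 where "s1 = rset ''E'' j (E j) (nset ''i'' 0 j (rset ''x'' 0 x s))"
  have "wp c pop_above (wp c (push_above ;; pop_below ;; push_below) ?Q) s1 (m - 28)"
  proof (rule wp_pop_above, goal_cases)
    case 1
    show ?case using LR by (simp add: s1_def L_def R_def)
  next
    case 2
    show ?case using m by (simp add: s1_def L_def R_def)
  next
    case (3 r m1)
    then have r: "L \<le> r" "r \<le> R" "r < R \<Longrightarrow> T (Suc r) - (x - X (Suc r)) * b r < A j"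
        "L < r \<Longrightarrow> A j \<le> T r - (x - X r) * b (r - 1)" "m - 28 \<le> m1 + 40 * (R - r) + 40"
      by (simp_all add: s1_def L_def R_def T_def X_def b_def same)
    define h where "h = (T r - A j) / (x - X r)"
    define T' X' b' where "T' = T(Suc r := A j)" and "X' = X(Suc r := x)" and "b' = b(r := h)"
    note above = pieces_cut_above[OF G Xx anti r(1-4) h_def, folded T'_def X'_def b'_def]
    define s2 where "s2 = rset ''X'' (Suc r) x (rset ''T'' (Suc r) (A j) (nset ''R'' 0 (Suc r)
      (rset ''b'' r h (rset ''hi'' j h (nset ''R'' 0 r s1)))))"
    have "wp c pop_below (wp c push_below ?Q) s2 (m1 - 40)"
    proof (rule wp_pop_below, goal_cases)
      case 1
      show ?case using r by (simp add: s2_def s1_def L_def)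
    next
      case 2
      show ?case using m r LR by (simp add: s2_def s1_def L_def R_def)
    next
      case (3 q m2)
      then have q: "L \<le> q" "q \<le> Suc r"
          "L < q \<Longrightarrow> E j < T' (q - 1) - (x - X' (q - 1)) * b' (q - 1)"
          "q < Suc r \<Longrightarrow> T' q - (x - X' q) * b' q \<le> E j" "m1 - 40 \<le> m2 + 40 * (q - L) + 40"
        by (simp_all add: s2_def s1_def L_def R_def T_def X_def b_def T'_def X'_def b'_def)
      define u where "u = (T' q - E j) / (x - X' q)"
      have anti': "max (A j) (G l') \<le> max (A j) (G l)" if "l \<le> l'" for l l'
        using anti[OF that] by (auto simp: max_def)
      have X': "X' k < x" if "L \<le> k" "k < Suc r" for k
        using that Xx[of k] r by (simp add: X'_def)
      \<comment> \<open>At the new last breakpoint \<open>h\<close> the cut function equals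
        \<open>A j\<close>, which is at most \<open>E j\<close> because the window has been
        widened.\<close>
      have last: "max (A j) (G (b' (Suc r - 1))) \<le> E j"
        using above(1) by (simp add: b'_def E_def)
      have q0: "0 < q" using q inv'(3) by simp
      have Lr: "L < Suc r" using r by simp
      note below = pieces_cut_below[OF above(2) X' anti' Lr last q(1,2) q0 q(3,4) u_def]
      \<comment> \<open>Since \<open>u \<le> h\<close>, the maximum with \<open>A j\<close> is
        inactive at \<open>u\<close>, so \<open>u\<close> is a root for \<open>G\<close> itself and
        not only for the cut function.\<close>
      have "A j \<le> G u"
        using anti[OF below(2)] above(1) by (simp add: b'_def)
      then have Gu: "G u = E j" using below(1) by simp
      define s3 where "s3 = rset ''X'' (q - 1) x (rset ''T'' (q - 1) (E j) (rset ''b'' (q - 1) u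
        (nset ''L'' 0 (q - 1) (rset ''lo'' j u (nset ''L'' 0 q s2)))))"
      have s3: "nats s3 ''i'' 0 = j" "nats s3 ''L'' 0 = q - 1" "nats s3 ''R'' 0 = Suc r"
          "reals s3 ''T'' = T'(q - 1 := E j)" "reals s3 ''X'' = X'(q - 1 := x)"
          "reals s3 ''b'' = b'(q - 1 := u)" "reals s3 ''x'' 0 = x"
          "reals s3 ''lo'' = (reals s ''lo'')(j := u)" "reals s3 ''hi'' = (reals s ''hi'')(j := h)"
        by (simp_all add: s3_def s2_def s1_def T'_def X'_def b'_def T_def X_def b_def)
      have inv3: "unchanged {''A'', ''D'', ''d'', ''v_min'', ''v_max'', ''t_start''} s0 s3"
        using inv'(1) by (simp add: unchanged_def s3_def s2_def s1_def)
      have roots: "depart n A E dd te k (reals s3 ''lo'' k) = E k \<and>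
          depart n A E dd te k (reals s3 ''hi'' k) = A k" if "j \<le> k" "k < n" for k
        using inv'(5)[of k] that Gu above(1) by (cases "k = j") (auto simp: s3 G_def)
      have pieces3: "pieces (q - 1) (Suc r) (reals s3 ''T'') (reals s3 ''X'') (reals s3 ''b'')
          (reals s3 ''x'' 0) (pos n A E dd te j)"
        using below(4) by (simp add: s3 pos)
      have j: "j \<le> n" "j \<le> q - 1"
        using inv'(2,3) q by auto
      have "backward_inv s0 s3"
        unfolding backward_inv_def Let_def s3(1-3)
      proof (intro conjI allI impI inv3 j[unfolded n_def])
        show "pieces (q - 1) (Suc r) (reals s3 ''T'') (reals s3 ''X'') (reals s3 ''b'')
            (reals s3 ''x'' 0) (pos (nats s0 ''n'' 0) (reals s0 ''A'')
              (\<lambda>k. max (reals s0 ''A'' k) (reals s0 ''D'' k)) (reals s0 ''d'') (reals s0 ''t_end'' 0) j)"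
          using pieces3 unfolding n_def A_def D_def dd_def te_def E_def .
      qed (use roots in \<open>auto simp: n_def A_def D_def dd_def te_def E_def\<close>)
      then have "?Q s3 (m2 - 40)"
        using r q m LR by (simp add: s3 ij flip: L_def R_def)
      moreover have "40 \<le> m2" using r q m LR by (simp flip: L_def R_def)
      ultimately show ?case
        using below(3)
        by (simp add: push_below_def wp_simps le_diff_conv2 s3_def s2_def s1_def u_def T'_def X'_def T_def X_def)
    qed
    moreover have "40 \<le> m1" using r m LR by (simp flip: L_def R_def)
    ultimately show ?case
      by (simp add: push_above_def wp_simps le_diff_conv2 s2_def s1_def h_def T_def X_def same)
  qed
  then show ?thesis
    using m by (simp add: backward_step_def wp_simps le_diff_conv2 wp_widen Let_def ij s1_def x_def E_def same)
qed

text \<open>A step pushes two pieces; the 40 units per piece in the potential pay for popping it.\<close>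
lemma wp_backward:
  fixes s :: store
  defines "pot \<equiv> \<lambda>s. 400 * nats s ''i'' 0 + 40 * (nats s ''R'' 0 - nats s ''L'' 0)"
  assumes inv: "backward_inv s0 s"
    and d: "\<And>i. i \<in> {1..nats s0 ''n'' 0} \<Longrightarrow> 0 < reals s0 ''d'' i"
    and m: "pot s + 20 \<le> m"
    and Q: "\<And>s' m'. backward_inv s0 s' \<Longrightarrow> nats s' ''i'' 0 = 0 \<Longrightarrow> m \<le> m' + pot s + 20 \<Longrightarrow> Q s' m'"
  shows "wp c backward Q s m"
  unfolding backward_def
proof (rule wp_While[where Inv = "\<lambda>s' m'. backward_inv s0 s' \<and> pot s' + 20 \<le> m' \<and>
    m + pot s' \<le> m' + pot s"], goal_cases)
  case 1
  show ?case using inv m by simp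
next
  case (2 s' m')
  show ?case
  proof (cases "0 < nats s' ''i'' 0")
    case True
    have "40 * (nats s' ''R'' 0 - nats s' ''L'' 0) + 300 \<le> m' - 5"
      using True 2 unfolding pot_def by linarith
    note step = wp_backward_step[OF conjunct1[OF 2] True d this]
    have "wp c backward_step
      (\<lambda>s' m'. backward_inv s0 s' \<and> pot s' + 20 \<le> m' \<and> m + pot s' \<le> m' + pot s) s' (m' - 5)"
      by (rule wp_mono[OF step]) (use True 2 in \<open>auto simp: pot_def\<close>)
    then show ?thesis using True 2 by (simp add: numeral_2_eq_2[symmetric] pot_def)
  next
    case False
    then show ?thesis using 2 Q[of s' "m' - 5"] by (auto simp: pot_def numeral_2_eq_2[symmetric])
  qed
qed

section \<open>Effect and running time of the forward phase\<close>

lemma wp_clamp: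
  fixes s :: store
  defines "i \<equiv> nats s ''i'' 0" and "lam \<equiv> reals s ''lam''" and "lo \<equiv> reals s ''lo''"
    and "hi \<equiv> reals s ''hi''"
  assumes "60 \<le> m"
    and "\<And>m'. m \<le> m' + 60 \<Longrightarrow> Q (rset ''lam'' (Suc i)
      (if lam i < lo i then lo i else if hi i < lam i then hi i else lam i) s) m'"
  shows "wp c clamp Q s m"
  \<comment> \<open>The three costs belong to raising the slope to \<open>lo\<close>, keeping it,
    and lowering it to \<open>hi\<close>.\<close>
  using assms(5) assms(6)[of "m - 24"] assms(6)[of "m - 25"] assms(6)[of "m - 32"]
  unfolding i_def lam_def lo_def hi_def by (auto simp: clamp_def wp_simps le_diff_conv2)

definition leg_ok :: "store \<Rightarrow> nat \<Rightarrow> bool" where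
  "leg_ok s k \<longleftrightarrow> reals s ''t'' k \<le> reals s ''D'' k \<and>
    reals s ''v_min'' 0 \<le> reals s ''v'' k \<and> reals s ''v'' k \<le> reals s ''v_max'' 0"

lemma wp_check:
  assumes "60 \<le> m"
    and "\<And>m'. m \<le> m' + 60 \<Longrightarrow>
      Q (if leg_ok s (nats s ''i'' 0) then s else nset ''feasible'' 0 0 s) m'"
  shows "wp c check Q s m"
  \<comment> \<open>A passed check costs 26 units, a failed one 28.\<close>
  using assms(1) assms(2)[of "m - 26"] assms(2)[of "m - 28"]
  by (auto simp: check_def leg_ok_def wp_simps le_diff_conv2 not_less)

text \<open>The recurrences are those assumed in \<open>taut_string\<close>; the flag records
  whether all legs so far passed \<open>check\<close>.\<close>

definition forward_inv :: "store \<Rightarrow> store \<Rightarrow> bool" where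
  "forward_inv s0 s \<longleftrightarrow>
    (let i = nats s ''i'' 0; lam = reals s ''lam''; lo = reals s0 ''lo''; hi = reals s0 ''hi'';
      t = reals s ''t''
     in unchanged {''A'', ''D'', ''d'', ''lo'', ''hi'', ''v_min'', ''v_max''} s0 s \<and>
      i \<le> nats s0 ''n'' 0 \<and> t 0 = reals s0 ''t'' 0 \<and>
      (\<forall>k<i. lam (Suc k) = (if lam k < lo k then lo k else if hi k < lam k then hi k else lam k) \<and>
        t (Suc k) = t k + reals s0 ''d'' (Suc k) * lam (Suc k) \<and>
        reals s ''v'' (Suc k) = 1 / lam (Suc k)) \<and>
      nats s ''feasible'' 0 = (if \<forall>k\<in>{1..i}. leg_ok s k then 1 else 0))"

lemma wp_forward:
  fixes s :: store
  assumes inv: "forward_inv s0 s" and m: "200 * (nats s0 ''n'' 0 - nats s ''i'' 0) + 20 \<le> m"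
    and Q: "\<And>s' m'. forward_inv s0 s' \<Longrightarrow> nats s' ''i'' 0 = nats s0 ''n'' 0 \<Longrightarrow> Q s' m'"
  shows "wp c forward Q s m"
  unfolding forward_def
proof (rule wp_While[where Inv = "\<lambda>s m. forward_inv s0 s \<and>
    200 * (nats s0 ''n'' 0 - nats s ''i'' 0) + 20 \<le> m"], goal_cases)
  case 1
  show ?case using inv m by simp
next
  case (2 s m)
  define i where "i = nats s ''i'' 0"
  have n: "nats s ''n'' 0 = nats s0 ''n'' 0" and le: "i \<le> nats s0 ''n'' 0"
    using 2 by (auto simp: forward_inv_def unchanged_def Let_def i_def)
  show ?case
  proof (cases "i < nats s0 ''n'' 0")
    case True
    define l where "l = (if reals s ''lam'' i < reals s ''lo'' i then reals s ''lo'' i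
      else if reals s ''hi'' i < reals s ''lam'' i then reals s ''hi'' i else reals s ''lam'' i)"
    define s1 where "s1 = nset ''i'' 0 (Suc i) (rset ''v'' (Suc i) (1 / l)
      (rset ''t'' (Suc i) (reals s ''t'' i + reals s ''d'' (Suc i) * l) (rset ''lam'' (Suc i) l s)))"
    define s2 where "s2 = (if leg_ok s1 (Suc i) then s1 else nset ''feasible'' 0 0 s1)"
    have s2: "nats s2 ''n'' = nats s ''n''" "nats s2 ''i'' 0 = Suc i"
        "nats s2 ''feasible'' 0 = (if leg_ok s2 (Suc i) then nats s ''feasible'' 0 else 0)"
        "reals s2 ''lam'' = (reals s ''lam'')(Suc i := l)"
        "reals s2 ''t'' = (reals s ''t'')(Suc i := reals s ''t'' i + reals s ''d'' (Suc i) * l)"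
        "reals s2 ''v'' = (reals s ''v'')(Suc i := 1 / l)"
        "\<And>x. x \<notin> {''lam'', ''t'', ''v''} \<Longrightarrow> reals s2 x = reals s x"
      by (auto simp: s2_def s1_def leg_ok_def)
    have un: "unchanged {''A'', ''D'', ''d'', ''lo'', ''hi'', ''v_min'', ''v_max''} s0 s"
      and t0: "reals s ''t'' 0 = reals s0 ''t'' 0"
      and steps: "\<And>k. k < i \<Longrightarrow> reals s ''lam'' (Suc k) = (if reals s ''lam'' k < reals s0 ''lo'' k
            then reals s0 ''lo'' k else if reals s0 ''hi'' k < reals s ''lam'' k
            then reals s0 ''hi'' k else reals s ''lam'' k) \<and>
          reals s ''t'' (Suc k) = reals s ''t'' k + reals s0 ''d'' (Suc k) * reals s ''lam'' (Suc k) \<and>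
          reals s ''v'' (Suc k) = 1 / reals s ''lam'' (Suc k)"
      and ok: "nats s ''feasible'' 0 = (if \<forall>k\<in>{1..i}. leg_ok s k then 1 else 0)"
      using 2 unfolding forward_inv_def Let_def i_def by blast+
    have un2: "unchanged {''A'', ''D'', ''d'', ''lo'', ''hi'', ''v_min'', ''v_max''} s0 s2"
      using un by (simp add: unchanged_def s2)
    \<comment> \<open>Only cell \<open>Suc i\<close> is written, so earlier verdicts
      persist.\<close>
    have "leg_ok s2 k \<longleftrightarrow> leg_ok s k" if "k \<in> {1..i}" for k
      using that by (auto simp: leg_ok_def s2)
    moreover have "{1..Suc i} = insert (Suc i) {1..i}" by auto
    ultimately have ok2: "nats s2 ''feasible'' 0 = (if \<forall>k\<in>{1..Suc i}. leg_ok s2 k then 1 else 0)"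
      using ok by (simp add: s2(3))
    have l: "l = (if reals s ''lam'' i < reals s0 ''lo'' i then reals s0 ''lo'' i
      else if reals s0 ''hi'' i < reals s ''lam'' i then reals s0 ''hi'' i else reals s ''lam'' i)"
      using un by (simp add: l_def unchanged_def)
    have d: "reals s ''d'' = reals s0 ''d''" using un by (simp add: unchanged_def)
    have steps2: "reals s2 ''lam'' (Suc k) = (if reals s2 ''lam'' k < reals s0 ''lo'' k
            then reals s0 ''lo'' k else if reals s0 ''hi'' k < reals s2 ''lam'' k
            then reals s0 ''hi'' k else reals s2 ''lam'' k) \<and>
          reals s2 ''t'' (Suc k) = reals s2 ''t'' k + reals s0 ''d'' (Suc k) * reals s2 ''lam'' (Suc k) \<and>
          reals s2 ''v'' (Suc k) = 1 / reals s2 ''lam'' (Suc k)" if "k < Suc i" for k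
      using that l steps[of k] by (cases "k = i") (simp_all add: s2 d)
    have inv2: "forward_inv s0 s2"
      unfolding forward_inv_def Let_def s2(2)
      using un2 True t0 ok2 steps2 by (auto simp: s2(5))
    \<comment> \<open>The loop test (6), the clamp (at most 60) and the three assignments (38) fit
      into 110 units.\<close>
    have "wp c check (\<lambda>s m. forward_inv s0 s \<and>
        200 * (nats s0 ''n'' 0 - nats s ''i'' 0) + 20 \<le> m) s1 m'" if m': "m \<le> m' + 110" for m'
    proof (rule wp_check)
      show "60 \<le> m'" using 2 True m' unfolding i_def[symmetric] by linarith
    next
      fix m'' assume "m' \<le> m'' + 60"
      moreover have i1: "nats s1 ''i'' 0 = Suc i" by (simp add: s1_def)
      ultimately show "forward_inv s0 (if leg_ok s1 (nats s1 ''i'' 0) then s1 else nset ''feasible'' 0 0 s1)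
          \<and> 200 * (nats s0 ''n'' 0 - nats (if leg_ok s1 (nats s1 ''i'' 0) then s1
            else nset ''feasible'' 0 0 s1) ''i'' 0) + 20 \<le> m''"
        using inv2 2 True m' unfolding i1 s2_def[symmetric] s2(2) i_def[symmetric] by linarith
    qed
    moreover have "wp c forward_step Q' s (m - 6)"
      if Q': "\<And>m'. m \<le> m' + 110 \<Longrightarrow> wp c check Q' s1 m'" for Q'
      unfolding forward_step_def wp_Seq
    proof (rule wp_clamp)
      show "60 \<le> m - 6" using 2 True unfolding i_def[symmetric] by linarith
    next
      fix m' assume m': "m - 6 \<le> m' + 60"
      have "110 \<le> m" using 2 True unfolding i_def[symmetric] by linarith
      then show "wp c (RSet ''t'' (inc (N ''i'')) (RAdd (RGet ''t'' (N ''i''))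
          (RMul (RGet ''d'' (inc (N ''i''))) (RGet ''lam'' (inc (N ''i''))))))
        (wp c (RSet ''v'' (inc (N ''i'')) (RDiv (RConst 1) (RGet ''lam'' (inc (N ''i'')))))
          (wp c (nassign ''i'' (inc (N ''i''))) (wp c check Q')))
        (rset ''lam'' (Suc (nats s ''i'' 0))
          (if reals s ''lam'' (nats s ''i'' 0) < reals s ''lo'' (nats s ''i'' 0)
           then reals s ''lo'' (nats s ''i'' 0)
           else if reals s ''hi'' (nats s ''i'' 0) < reals s ''lam'' (nats s ''i'' 0)
           then reals s ''hi'' (nats s ''i'' 0) else reals s ''lam'' (nats s ''i'' 0)) s) m'"
        using m' Q'[of "m' - 38"] unfolding i_def[symmetric] l_def[symmetric]
        by (auto simp: wp_simps le_diff_conv2 s1_def i_def[symmetric])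
    qed
    ultimately have "wp c forward_step
      (\<lambda>s m. forward_inv s0 s \<and> 200 * (nats s0 ''n'' 0 - nats s ''i'' 0) + 20 \<le> m) s (m - 6)"
      by blast
    moreover have "6 \<le> m" using 2 by linarith
    moreover have "bval c (NLess (N ''i'') (N ''n'')) s" using True n by (simp add: i_def)
    moreover have "1 + bcost (NLess (N ''i'') (N ''n'')) = 6" by simp
    ultimately show ?thesis
      by presburger
  next
    case False
    then have "i = nats s0 ''n'' 0" using le by simp
    moreover have "1 + bcost (NLess (N ''i'') (N ''n'')) = 6" by simp
    moreover have "6 \<le> m" using 2 by linarith
    moreover have "\<not> bval c (NLess (N ''i'') (N ''n'')) s" using False n by (simp add: i_def)
    ultimately show ?thesis using 2 Q[of s "m - 6"] by (simp only: i_def if_False)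
  qed
qed

section \<open>Correctness\<close>

definition prepared :: "instance_data \<Rightarrow> store" where
  "prepared I = (let n = legs I in
    rset ''T'' n (t_end I) (rset ''D'' n (t_end I) (rset ''D'' 0 (t_start I) (rset ''A'' 0 (t_start I)
      (nset ''R'' 0 n (nset ''L'' 0 n (nset ''i'' 0 n (input_store I))))))))"

lemma prepared_sel:
  assumes "1 \<le> legs I"
  shows "nats (prepared I) ''n'' 0 = legs I"
    and "reals (prepared I) ''t_start'' 0 = t_start I" "reals (prepared I) ''t_end'' 0 = t_end I"
    and "reals (prepared I) ''v_min'' 0 = v_min I" "reals (prepared I) ''v_max'' 0 = v_max I"
    and "reals (prepared I) ''A'' 0 = t_start I" "reals (prepared I) ''D'' 0 = t_start I"
    and "reals (prepared I) ''D'' (legs I) = t_end I"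
    and "\<And>k. k \<in> {1..legs I - 1} \<Longrightarrow> reals (prepared I) ''A'' k = win_open I k"
    and "\<And>k. k \<in> {1..legs I - 1} \<Longrightarrow> reals (prepared I) ''D'' k = win_close I k"
    and "\<And>k. k \<in> {1..legs I} \<Longrightarrow> reals (prepared I) ''d'' k = dist I k"
  using assms by (auto simp: prepared_def Let_def input_store_def)

text \<open>Initially the deque holds one constant piece of value \<open>t_end\<close>, at index
  \<open>n\<close>, which leaves \<open>n\<close> free cells on its left.\<close>

lemma backward_inv_prepared:
  assumes "1 \<le> legs I"
  shows "backward_inv (prepared I) (prepared I)"
proof -
  have "nats (prepared I) ''i'' 0 = legs I" "nats (prepared I) ''L'' 0 = legs I"
      "nats (prepared I) ''R'' 0 = legs I" "reals (prepared I) ''x'' 0 = 0"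
      "reals (prepared I) ''X'' (legs I) = 0" "reals (prepared I) ''T'' (legs I) = t_end I"
    by (simp_all add: prepared_def Let_def input_store_def)
  then show ?thesis
    using assms
    by (auto simp: backward_inv_def Let_def unchanged_def prepared_sel pieces_def pos.simps[of "legs I"])
qed

definition restarted :: "instance_data \<Rightarrow> store \<Rightarrow> store" where
  "restarted I s = rset ''t'' 0 (t_start I) (nset ''feasible'' 0 1 (nset ''i'' 0 0 s))"

text \<open>The string is compared with an arbitrary feasible schedule. If one exists,
  \<open>taut_bounds\<close> shows that the string keeps the speed limits, and
  \<open>taut_optimal\<close> with cost \<open>c (1 / p)\<close> shows that it is no more expensive.
  Without one, the string fails some check.\<close>

lemma correct:
  assumes I: "speed_instance I"
    and bw: "backward_inv (prepared I) s1" "nats s1 ''i'' 0 = 0"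
    and fw: "forward_inv (restarted I s1) s" "nats s ''i'' 0 = legs I"
  shows "correct_output I s"
proof -
  define n d te where "n = legs I" and "d = reals (prepared I) ''d''" and "te = t_end I"
  define A D where "A = reals (prepared I) ''A''" and "D = reals (prepared I) ''D''"
  define E where "E k = max (A k) (D k)" for k
  define lam lo hi where "lam = reals s ''lam''" and "lo = reals s1 ''lo''" and "hi = reals s1 ''hi''"
  define t v where "t = reals s ''t''" and "v = reals s ''v''"
  have n: "1 \<le> n" and dist: "\<And>i. i \<in> {1..n} \<Longrightarrow> 0 < dist I i"
    and speeds: "0 < v_min I" "v_min I \<le> v_max I"
    and fuel: "mono_on {v_min I..v_max I} (fuel I)" "convex_on {v_min I..v_max I} (fuel I)"
    using I by (auto simp: speed_instance_def n_def)
  note sel = prepared_sel[OF n[unfolded n_def], folded n_def A_def D_def d_def te_def]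
  have d: "0 < d i" if "i \<in> {1..n}" for i using dist sel(11) that by simp
  have un1: "unchanged {''A'', ''D'', ''d'', ''v_min'', ''v_max'', ''t_start''} (prepared I) s1"
    using bw(1) unfolding backward_inv_def Let_def by blast
  have un: "unchanged {''A'', ''D'', ''d'', ''lo'', ''hi'', ''v_min'', ''v_max''} (restarted I s1) s"
    using fw(1) unfolding forward_inv_def Let_def by blast
  have same: "reals s ''D'' = D" "reals s ''v_min'' 0 = v_min I" "reals s ''v_max'' 0 = v_max I"
      "reals (restarted I s1) ''d'' = d" "reals (restarted I s1) ''lo'' = lo"
      "reals (restarted I s1) ''hi'' = hi"
    using un un1 sel(4,5) by (auto simp: unchanged_def restarted_def D_def d_def lo_def hi_def)
  have roots: "depart n A E d te k (lo k) = E k \<and> depart n A E d te k (hi k) = A k" if "k < n" for k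
    using bw that unfolding backward_inv_def Let_def E_def[abs_def] n_def A_def D_def d_def te_def
      lo_def hi_def prepared_sel[OF n[unfolded n_def]] by simp
  have t0: "t 0 = A 0"
    using fw(1) sel(6) by (simp add: forward_inv_def Let_def restarted_def t_def)
  have "\<And>k. k < n \<Longrightarrow>
      lam (Suc k) = (if lam k < lo k then lo k else if hi k < lam k then hi k else lam k) \<and>
      t (Suc k) = t k + d (Suc k) * lam (Suc k) \<and> v (Suc k) = 1 / lam (Suc k)"
    using fw unfolding forward_inv_def Let_def same n_def lam_def t_def v_def by simp
  then have lam: "\<And>k. k < n \<Longrightarrow>
      lam (Suc k) = (if lam k < lo k then lo k else if hi k < lam k then hi k else lam k)"
    and t: "\<And>k. k < n \<Longrightarrow> t (Suc k) = t k + d (Suc k) * lam (Suc k)"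
    and v': "\<And>k. k < n \<Longrightarrow> v (Suc k) = 1 / lam (Suc k)"
    by blast+
  have flag: "nats s ''feasible'' 0 = (if \<forall>k\<in>{1..n}. leg_ok s k then 1 else 0)"
    using fw unfolding forward_inv_def Let_def n_def by simp
  have leg_ok: "leg_ok s k \<longleftrightarrow> t k \<le> D k \<and> v_min I \<le> v k \<and> v k \<le> v_max I" for k
    by (simp add: leg_ok_def same t_def v_def)
  have v: "v k = 1 / lam k" and step: "t k - t (k - 1) = d k * lam k" if "k \<in> {1..n}" for k
    using that v'[of "k - 1"] t[of "k - 1"] by (auto simp: Suc_diff_Suc)
  have "0 < n" "E 0 = A 0" using n sel(6,7) by (auto simp: E_def)
  note taut = taut_string[where t = t and lam = lam and D = E, OF \<open>0 < n\<close> d _ _ roots lam t0 t]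
  have tn: "t n = te" and tA: "\<And>k. k < n \<Longrightarrow> A k \<le> t k \<and> t k \<le> E k"
    and up: "\<And>k. 0 < k \<Longrightarrow> k < n \<Longrightarrow> lam k < lam (Suc k) \<Longrightarrow> t k = E k"
    and down: "\<And>k. 0 < k \<Longrightarrow> k < n \<Longrightarrow> lam (Suc k) < lam k \<Longrightarrow> t k = A k"
    using taut \<open>E 0 = A 0\<close> by (auto simp: E_def)
  \<comment> \<open>At node \<open>n\<close> the deadline test holds because both sides equal
    \<open>t_end\<close>; opening times come from \<open>tA\<close>.\<close>
  have feasible_iff: "feasible I (t, v) \<longleftrightarrow> (\<forall>k\<in>{1..n}. leg_ok s k)"
  proof
    assume *: "feasible I (t, v)"
    show "\<forall>k\<in>{1..n}. leg_ok s k"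
    proof
      fix k assume k: "k \<in> {1..n}"
      then show "leg_ok s k"
        using * sel(8,10) tn by (cases "k = n") (auto simp: feasible_def leg_ok n_def)
    qed
  next
    assume *: "\<forall>k\<in>{1..n}. leg_ok s k"
    show "feasible I (t, v)"
      unfolding feasible_def prod.case n_def[symmetric]
    proof (intro conjI ballI)
      fix k assume "k \<in> {1..n}"
      then show "t (k - 1) + dist I k / v k = t k"
        using step[of k] v[of k] sel(11)[of k] by simp
    next
      fix k assume "k \<in> {1..n - 1}"
      then show "win_open I k \<le> t k" "t k \<le> win_close I k"
        using sel(9,10)[of k] tA[of k] bspec[OF *, of k] by (auto simp: leg_ok)
    qed (use * t0 tn sel(6) in \<open>auto simp: leg_ok te_def\<close>)
  qed
  have optimal: "feasible I (t, v) \<and> total_cost I (t, v) \<le> total_cost I (s', w)"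
    if feas: "feasible I (s', w)" for s' w
  proof -
    have w: "v_min I \<le> w k \<and> w k \<le> v_max I" and s': "s' k - s' (k - 1) = d k * (1 / w k)"
      if "k \<in> {1..n}" for k
      using feas that sel(11)[of k] by (auto simp: feasible_def n_def algebra_simps)
    have win: "A k \<le> s' k \<and> s' k \<le> D k" if "k \<in> {1..<n}" for k
      using feas that sel(9,10)[of k] by (auto simp: feasible_def n_def)
    \<comment> \<open>A feasible schedule shows that the interior windows are nonempty, so widening
      has not changed them.\<close>
    then have E: "E k = D k" if "k \<in> {1..<n}" for k
      using that by (force simp: E_def)
    have ends: "s' 0 = t 0" "s' n = t n"
      using feas t0 tn sel(6) by (auto simp: feasible_def n_def te_def)
    have up': "s' k \<le> t k" if "k \<in> {1..<n}" "lam k < lam (Suc k)" for k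
      using up[of k] that win[of k] E[of k] by auto
    have down': "t k \<le> s' k" if "k \<in> {1..<n}" "lam (Suc k) < lam k" for k
      using down[of k] that win[of k] by auto
    have q: "1 / w k \<in> {1 / v_max I..1 / v_min I}" if "k \<in> {1..n}" for k
      using w[OF that] speeds by (auto intro!: divide_left_mono)
    \<comment> \<open>The string inherits the slope bounds of the competing schedule.\<close>
    have bounds: "lam k \<in> {1 / v_max I..1 / v_min I}" if "k \<in> {1..n}" for k
      by (rule taut_bounds[OF d step s' ends up' down' q that])
    have ok: "leg_ok s k" if k: "k \<in> {1..n}" for k
    proof -
      have "0 < 1 / v_max I" using speeds by simp
      then have "0 < lam k" using bounds[OF k] unfolding atLeastAtMost_iff by linarith
      then have "v_min I \<le> v k \<and> v k \<le> v_max I"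
        using bounds[OF k] speeds by (simp add: v[OF k] field_simps)
      moreover have "t k \<le> D k"
        using tA[of k] E[of k] tn sel(8) k by (cases "k = n") auto
      ultimately show ?thesis by (simp add: leg_ok)
    qed
    have "(\<Sum>i=1..n. d i * fuel I (1 / lam i)) \<le> (\<Sum>i=1..n. d i * fuel I (1 / (1 / w i)))"
      by (rule taut_optimal[where f = "\<lambda>p. fuel I (1 / p)", OF _ step s' ends up' down'
            convex_on_comp_inverse[OF speeds fuel] bounds q])
        (use d in \<open>auto simp: less_imp_le\<close>)
    then have "total_cost I (t, v) \<le> total_cost I (s', w)"
      using v sel(11) by (simp add: total_cost_def flip: n_def)
    then show ?thesis using ok feasible_iff by blast
  qed
  show ?thesis
  proof (cases "\<exists>x. feasible I x")
    case True
    then have "feasible I (t, v)" using optimal by fast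
    moreover have "optimal_solution I (t, v)"
      unfolding optimal_solution_def is_arg_min_def
      using True optimal by (auto simp: not_less)
    ultimately show ?thesis
      using True flag feasible_iff by (simp add: correct_output_def t_def v_def)
  next
    case False
    then show ?thesis
      using flag feasible_iff by (auto simp: correct_output_def)
  qed
qed

lemma wp_program:
  assumes I: "speed_instance I"
  shows "wp (fuel I) program (\<lambda>s m. correct_output I s) (input_store I) (1000 * legs I + 1000)"
proof -
  have n: "1 \<le> legs I" using I by (simp add: speed_instance_def)
  \<comment> \<open>The assignments before \<open>backward\<close> cost 30 units.\<close>
  have "wp (fuel I) backward (wp (fuel I) (nassign ''i'' (NConst 0) ;;
      nassign ''feasible'' (NConst 1) ;; rassign ''t'' (V ''t_start'') ;; forward)
    (\<lambda>s m. correct_output I s)) (prepared I) (1000 * legs I + 970)"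
  proof (rule wp_backward[OF backward_inv_prepared[OF n]])
    fix i assume "i \<in> {1..nats (prepared I) ''n'' 0}"
    then show "0 < reals (prepared I) ''d'' i"
      using I n by (simp add: prepared_sel speed_instance_def)
  next
    have pot: "nats (prepared I) ''i'' 0 = legs I" "nats (prepared I) ''L'' 0 = legs I"
      "nats (prepared I) ''R'' 0 = legs I"
      by (simp_all add: prepared_def Let_def)
    then show "400 * nats (prepared I) ''i'' 0 +
      40 * (nats (prepared I) ''R'' 0 - nats (prepared I) ''L'' 0) + 20 \<le> 1000 * legs I + 970"
      by simp
    fix s m
    assume s: "backward_inv (prepared I) s" "nats s ''i'' 0 = 0"
      and "1000 * legs I + 970 \<le> m + (400 * nats (prepared I) ''i'' 0 +
      40 * (nats (prepared I) ''R'' 0 - nats (prepared I) ''L'' 0)) + 20"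
    then have m: "600 * legs I + 940 \<le> m" by (simp add: pot)
    have un: "unchanged {''A'', ''D'', ''d'', ''v_min'', ''v_max'', ''t_start''} (prepared I) s"
      using s(1) unfolding backward_inv_def Let_def by blast
    then have "reals s ''t_start'' 0 = t_start I" "nats s ''n'' 0 = legs I"
      using n by (simp_all add: unchanged_def prepared_sel)
    \<comment> \<open>The three assignments between the phases cost 10 units.\<close>
    moreover have "wp (fuel I) forward (\<lambda>s m. correct_output I s) (restarted I s) (m - 10)"
    proof (rule wp_forward)
      show "forward_inv (restarted I s) (restarted I s)"
        by (simp add: forward_inv_def Let_def unchanged_def restarted_def)
      show "200 * (nats (restarted I s) ''n'' 0 - nats (restarted I s) ''i'' 0) + 20 \<le> m - 10"
        using m \<open>nats s ''n'' 0 = legs I\<close> by (simp add: restarted_def)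
      show "correct_output I s'"
        if "forward_inv (restarted I s) s'" "nats s' ''i'' 0 = nats (restarted I s) ''n'' 0" for s' m'
        using correct[OF I s that(1)] that(2) \<open>nats s ''n'' 0 = legs I\<close>
        by (simp add: restarted_def)
    qed
    ultimately show "wp (fuel I) (nassign ''i'' (NConst 0) ;;
      nassign ''feasible'' (NConst 1) ;; rassign ''t'' (V ''t_start'') ;; forward)
      (\<lambda>s m. correct_output I s) s m"
      using m by (simp add: wp_simps restarted_def le_diff_conv2)
  qed
  then show ?thesis
    unfolding program_def
    by (simp add: wp_simps prepared_def Let_def input_store_def le_diff_conv2 add.commute)
qed

theorem mainTheorem9:
  "\<exists>P T. solves_in_time P T \<and>
     (\<lambda>n. real (T n)) \<in> O(\<lambda>n. real n * ln (real n))"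
proof (intro exI conjI)
  \<comment> \<open>The running time is even linear, which lies within the claimed bound.\<close>
  show "solves_in_time program (\<lambda>n. 1000 * n + 1000)"
    using wp_program by (fastforce simp: solves_in_time_def wp_def)
  show "(\<lambda>n. real (1000 * n + 1000)) \<in> O(\<lambda>n. real n * ln (real n))"
    by real_asymp
qed

end
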